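(* Let $\mathcal{A}\subset\mathbb{R}^n$ be compact and let $\mathcal{H}=(C,f,D,g)$ be a hybrid system with inputs satisfying the hybrid basic conditions. Suppose there exists a control Lyapunov function $V$ with $\mathcal{U}$ controls for $\mathcal{H}$ (with respect to $\mathcal{A}$). Suppose moreover that: (M1) the set-valued maps $\Psi_c$ and $\Psi_d$ are lower semicontinuous with convex values; (M2) for every $r>0$ and every $x\in\Pi(C)\cap\mathcal{I}(r)$, the function $u_c\mapsto\Gamma_c(x,u_c,r)$ is convex on $\Psi_c(x)$, and, for every $r>0$ and every $x\in\Pi(D)\cap\mathcal{I}(r)$, the function $u_d\mapsto\Gamma_d(x,u_d,r)$ is convex on $\Psi_d(x)$. Let $\rho_{c,0}:\mathbb{R}^n\to\mathcal{U}_c$, $\rho_{d,0}:\mathbb{R}^n\to\mathcal{U}_d$ be a feedback law pair, and let $\mathcal{T}'_c,\mathcal{T}'_d$ be the associated set-valued maps. If (M3) every maximal solution $t\mapsto\phi(t,0)$ to $\dot x=f(x,\rho_{c,0}(x))$, $x\in\Pi(C)\cap\mathcal{A}$, satisfies $|\phi(t,0)|_{\mathcal{A}}=0$ for all $(t,0)\in\mathrm{dom}\,\phi$; (M4) every maximal solution $j\mapsto\phi(0,j)$ to $x^+=g(x,\rho_{d,0}(x))$, $x\in\Pi(D)\cap\mathcal{A}$, satisfies $|\phi(0,j)|_{\mathcal{A}}=0$ for all $(0,j)\in\mathrm{dom}\,\phi$; (M5) the set-valued map $\mathcal{T}'_c$ is lower semicontinuous at each $x\in\Pi(C)\cap\mathcal{I}(0)$;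 (M6) the set-valued map $\mathcal{T}'_d$ is lower semicontinuous at each $x\in\Pi(D)\cap\mathcal{I}(0)$; then the state-feedback law pair $\rho_c:\Pi(C)\to\mathcal{U}_c$, $\rho_d:\Pi(D)\to\mathcal{U}_d$ defined as $$\rho_c(x):=\arg\min\{|u_c| : u_c\in\mathcal{T}'_c(x)\}\quad\forall x\in\Pi(C),$$ $$\rho_d(x):=\arg\min\{|u_d| : u_d\in\mathcal{T}'_d(x)\}\quad\forall x\in\Pi(D)$$ renders the compact set $\mathcal{A}$ globally asymptotically stable for $\mathcal{H}$. Furthermore, if the set-valued maps $\Psi_c$ and $\Psi_d$ have closed graph and $\rho_{c,0}(x)=0$, $\rho_{d,0}(x)=0$ for all $x\in\mathcal{A}$, then $\rho_c$ and $\rho_d$ are continuous.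
   Context: Hybrid system. Let $\mathcal{U}_c\subset\mathbb{R}^{m_c}$, $\mathcal{U}_d\subset\mathbb{R}^{m_d}$, $\mathcal{U}=\mathcal{U}_c\times\mathcal{U}_d$. A hybrid system $\mathcal{H}=(C,f,D,g)$ with state $x\in\mathbb{R}^n$ and input $u=(u_c,u_d)\in\mathcal{U}$ is $$\dot x=f(x,u_c),\ (x,u_c)\in C;\qquad x^+=g(x,u_d),\ (x,u_d)\in D,$$ with $C\subset\mathbb{R}^n\times\mathcal{U}_c$, $D\subset\mathbb{R}^n\times\mathcal{U}_d$, $f:\mathbb{R}^n\times\mathbb{R}^{m_c}\to\mathbb{R}^n$, $g:\mathbb{R}^n\times\mathbb{R}^{m_d}\to\mathbb{R}^n$. It satisfies the hybrid basic conditions if $C$ and $D$ are closed subsets of $\mathbb{R}^n\times\mathcal{U}_c$ and $\mathbb{R}^n\times\mathcal{U}_d$, respectively, and $f$ and $g$ are continuous. Projections. $\Pi(C)=\{x:\exists u_c\in\mathcal{U}_c,\ (x,u_c)\in C\}$, $\Pi(D)=\{x:\exists u_d\in\mathcal{U}_d,\ (x,u_d)\in D\}$; $\Psi_c(x)=\{u_c:(x,u_c)\in C\}$, $\Psi_d(x)=\{u_d:(x,u_d)\in D\}$ for $x\in\mathbb{R}^n$. A set-valued map $S:\mathbb{R}^n\rightrightarrows\mathbb{R}^m$ is lower semicontinuous at $x$ if $\liminf_{x_i\to x}S(x_i)\supset S(x)$, where $\liminf_{x_i\to x}S(x_i)=\{z:\forall x_i\to x,\ \exists z_i\to z\text{ s.t.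 }z_i\in S(x_i)\}$; it is lower semicontinuous if this holds at each $x\in\mathbb{R}^n$. Control Lyapunov function (CLF). $|\cdot|$ is the Euclidean norm and $|x|_{\mathcal{A}}=\inf_{y\in\mathcal{A}}|x-y|$. Class $\mathcal{K}_\infty$: functions $[0,\infty)\to[0,\infty)$ that are continuous, zero at zero, strictly increasing and unbounded. A continuous function $V:\mathbb{R}^n\to\mathbb{R}$, continuously differentiable on an open set containing $\overline{\Pi(C)}$, is a CLF with $\mathcal{U}$ controls for $\mathcal{H}$ if there exist $\alpha_1,\alpha_2\in\mathcal{K}_\infty$ and a positive definite function $\alpha_3$ such that - $\alpha_1(|x|_{\mathcal{A}})\le V(x)\le\alpha_2(|x|_{\mathcal{A}})$ for all $x\in\Pi(C)\cup\Pi(D)\cup g(D)$; - $\inf_{u_c\in\Psi_c(x)}\langle\nabla V(x),f(x,u_c)\rangle\le-\alpha_3(|x|_{\mathcal{A}})$ for all $x\in\Pi(C)$; - $\inf_{u_d\in\Psi_d(x)}V(g(x,u_d))-V(x)\le-\alpha_3(|x|_{\mathcal{A}})$ for all $x\in\Pi(D)$. Derived objects (for the given $V$, $\alpha_3$). For $r\ge0$, $\mathcal{I}(r)=\{x\in\mathbb{R}^n:V(x)\ge r\}$. $\Gamma_c(x,u_c,r)=\langle\nabla V(x),f(x,u_c)\rangle+\alpha_3(|x|_{\mathcal{A}})$ if $(x,u_c)\in C\cap(\mathcal{I}(r)\times\mathbb{R}^{m_c})$, and $-\infty$ otherwise. $\Gamma_d(x,u_d,r)=V(g(x,u_d))-V(x)+\alpha_3(|x|_{\mathcal{A}})$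 if $(x,u_d)\in D\cap(\mathcal{I}(r)\times\mathbb{R}^{m_d})$, and $-\infty$ otherwise. For $\star\in\{c,d\}$, writing $K_c=C$, $K_d=D$: $S^\circ_\star(x,r)=\{u_\star\in\mathcal{U}_\star:\Gamma_\star(x,u_\star,r)\le0\}$ if $x\in\Pi(K_\star)\cap\mathcal{I}(r)$, and $S^\circ_\star(x,r)=\mathbb{R}^{m_\star}$ otherwise. Given the pair $(\rho_{c,0},\rho_{d,0})$, $S'_\star(x,r)=S^\circ_\star(x,r)$ if $r>0$ and $S'_\star(x,r)=\{\rho_{\star,0}(x)\}$ if $r=0$. Finally, $\mathcal{T}'_\star(x)=\Psi_\star(x)\cap S'_\star(x,V(x))$. Closed loop. Applying a feedback pair $(\rho_c,\rho_d)$ to $\mathcal{H}$ gives $\dot x=f(x,\rho_c(x))$ for $x\in\{x:(x,\rho_c(x))\in C\}$ and $x^+=g(x,\rho_d(x))$ for $x\in\{x:(x,\rho_d(x))\in D\}$ ($x$ ranging over the domain of the respective feedback). Solutions. A hybrid time domain is a set $E\subset[0,\infty)\times\mathbb{N}$ such that for each $(T,J)\in E$, $E\cap([0,T]\times\{0,\dots,J\})=\bigcup_{j}([t_j,t_{j+1}],j)$ for a finite sequence $0=t_0\le t_1\le\cdots$. Solutions of the closed loop are functions $\phi$ on hybrid time domains, with $t\mapsto\phi(t,j)$ absolutely continuous on $\{t:(t,j)\in\mathrm{dom}\,\phi\}$ for each $j$, satisfying the flow dynamics along each such interval and the jump dynamics at each jump. A solution is complete if its domain is unbounded and maximal if it is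 not a truncation of another solution to a proper subset of the latter's domain. Asymptotic stability. A compact set $K$ is asymptotically stable for a closed-loop system if: for each $\varepsilon>0$ there exists $\delta>0$ such that each maximal solution $\phi$ starting from $K+\delta\mathbb{B}$ satisfies $\phi(t,j)\in K+\varepsilon\mathbb{B}$ for each $(t,j)\in\mathrm{dom}\,\phi$; and each maximal solution is bounded and the complete ones satisfy $\lim_{t+j\to\infty}|\phi(t,j)|_K=0$. Here $\mathbb{B}$ is the closed unit ball. The second property is required of all maximal solutions from every initial condition, so "globally asymptotically stable" refers to the same two properties.
   Formalization: The positive definite function α₃ is taken to be continuous (the claim fails otherwise), A is nonempty, and the arg min defining ρ_c and ρ_d is assumed to exist at every point of Π(C) and Π(D), since the hypotheses do not guarantee it. *)

theory Defs
  imports "HOL-Analysis.Analysis"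
begin

section \<open>Set-valued maps\<close>

text \<open>A set-valued map is a function into sets. In the inner limit, \<open>z\<^sub>i \<in> S (x\<^sub>i)\<close> is required for all
  sufficiently large \<open>i\<close> (the Painleve-Kuratowski inner limit): a limit must not depend on
  finitely many initial terms. The sequence \<open>x\<^sub>i\<close> ranges over the whole space and is not
  confined to the domain of \<open>S\<close>.\<close>

definition inner_limit ::
  "('a::topological_space \<Rightarrow> 'b::topological_space set) \<Rightarrow> 'a \<Rightarrow> 'b set" where
  "inner_limit S x =
     {z. \<forall>X. X \<longlonglongrightarrow> x \<longrightarrow> (\<exists>Z. Z \<longlonglongrightarrow> z \<and> (\<forall>\<^sub>F i in sequentially. Z i \<in> S (X i)))}"

definition lsc_at ::
  "('a::topological_space \<Rightarrow> 'b::topological_space set) \<Rightarrow> 'a \<Rightarrow> bool" where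
  "lsc_at S x \<longleftrightarrow> S x \<subseteq> inner_limit S x"

definition lsc :: "('a::topological_space \<Rightarrow> 'b::topological_space set) \<Rightarrow> bool" where
  "lsc S \<longleftrightarrow> (\<forall>x. lsc_at S x)"

definition has_closed_graph ::
  "('a::topological_space \<Rightarrow> 'b::topological_space set) \<Rightarrow> bool" where
  "has_closed_graph S \<longleftrightarrow> closed {(x, u). u \<in> S x}"

section \<open>Comparison functions, gradients, convexity\<close>

definition class_Kinf :: "(real \<Rightarrow> real) \<Rightarrow> bool" where
  "class_Kinf \<alpha> \<longleftrightarrow> continuous_on {0..} \<alpha> \<and> \<alpha> 0 = 0 \<and> strict_mono_on {0..} \<alpha> \<and>
     (\<forall>M. \<exists>s\<ge>0. \<alpha> s > M)"

text \<open>As usual in Lyapunov theory, positive definite functions are continuous by convention.\<close>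

definition pos_def_fun :: "(real \<Rightarrow> real) \<Rightarrow> bool" where
  "pos_def_fun \<alpha> \<longleftrightarrow> continuous_on {0..} \<alpha> \<and> \<alpha> 0 = 0 \<and> (\<forall>s>0. \<alpha> s > 0)"

definition grad :: "('a::real_inner \<Rightarrow> real) \<Rightarrow> 'a \<Rightarrow> 'a" where
  "grad V x = (THE D. GDERIV V x :> D)"

definition C1_on :: "'a set \<Rightarrow> ('a::real_inner \<Rightarrow> real) \<Rightarrow> bool" where
  "C1_on X V \<longleftrightarrow> (\<forall>x\<in>X. GDERIV V x :> grad V x) \<and> continuous_on X (grad V)"

text \<open>The library's \<open>convex_on\<close> is for real-valued functions. This version is only used for
  functions that never take the value \<open>\<infinity>\<close>.\<close>

definition ereal_convex_on :: "'a::real_vector set \<Rightarrow> ('a \<Rightarrow> ereal) \<Rightarrow> bool" where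
  "ereal_convex_on X h \<longleftrightarrow> convex X \<and>
     (\<forall>u\<in>X. \<forall>v\<in>X. \<forall>s\<in>{0..1}.
        h ((1 - s) *\<^sub>R u + s *\<^sub>R v) \<le> ereal (1 - s) * h u + ereal s * h v)"

section \<open>Hybrid systems with inputs\<close>

record ('n::finite, 'mc::finite, 'md::finite) hybrid_system =
  U_c :: "(real ^ 'mc) set"
  U_d :: "(real ^ 'md) set"
  flow_set :: "((real ^ 'n) \<times> (real ^ 'mc)) set"
  flow_map :: "(real ^ 'n) \<times> (real ^ 'mc) \<Rightarrow> real ^ 'n"
  jump_set :: "((real ^ 'n) \<times> (real ^ 'md)) set"
  jump_map :: "(real ^ 'n) \<times> (real ^ 'md) \<Rightarrow> real ^ 'n"

text \<open>\<open>closedin\<close> contains the standing inclusions \<open>C \<subseteq> \<real>\<^sup>n \<times> U\<^sub>c\<close> and \<open>D \<subseteq> \<real>\<^sup>n \<times> U\<^sub>d\<close>. Closedness is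
  relative; the input sets themselves need not be closed.\<close>

definition hybrid_basic_conditions :: "('n::finite, 'mc::finite, 'md::finite) hybrid_system \<Rightarrow> bool"
  where
  "hybrid_basic_conditions H \<longleftrightarrow>
     closedin (top_of_set (UNIV \<times> U_c H)) (flow_set H) \<and>
     closedin (top_of_set (UNIV \<times> U_d H)) (jump_set H) \<and>
     continuous_on UNIV (flow_map H) \<and> continuous_on UNIV (jump_map H)"

definition proj_set :: "'u set \<Rightarrow> ('x \<times> 'u) set \<Rightarrow> 'x set" where
  "proj_set U K = {x. \<exists>u\<in>U. (x, u) \<in> K}"

definition Pi_c :: "('n::finite, 'mc::finite, 'md::finite) hybrid_system \<Rightarrow> (real ^ 'n) set" where
  "Pi_c H = proj_set (U_c H) (flow_set H)"

definition Pi_d :: "('n::finite, 'mc::finite, 'md::finite) hybrid_system \<Rightarrow> (real ^ 'n) set" where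
  "Pi_d H = proj_set (U_d H) (jump_set H)"

definition Psi_c :: "('n::finite, 'mc::finite, 'md::finite) hybrid_system \<Rightarrow> real ^ 'n \<Rightarrow> (real ^ 'mc) set"
  where
  "Psi_c H x = {u. (x, u) \<in> flow_set H}"

definition Psi_d :: "('n::finite, 'mc::finite, 'md::finite) hybrid_system \<Rightarrow> real ^ 'n \<Rightarrow> (real ^ 'md) set"
  where
  "Psi_d H x = {u. (x, u) \<in> jump_set H}"

section \<open>Control Lyapunov functions\<close>

text \<open>\<open>\<alpha>\<^sub>3\<close> is a parameter because the maps below depend on it. The infima are taken in the
  extended reals: the first one may be \<open>-\<infinity>\<close>, for which the real-valued \<open>Inf\<close> is unspecified.\<close>

definition CLF_with ::
  "('n::finite, 'mc::finite, 'md::finite) hybrid_system \<Rightarrow> (real ^ 'n) set \<Rightarrow> (real ^ 'n \<Rightarrow> real)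
     \<Rightarrow> (real \<Rightarrow> real) \<Rightarrow> bool" where
  "CLF_with H A V \<alpha>\<^sub>3 \<longleftrightarrow>
     continuous_on UNIV V \<and>
     (\<exists>X. open X \<and> closure (Pi_c H) \<subseteq> X \<and> C1_on X V) \<and>
     pos_def_fun \<alpha>\<^sub>3 \<and>
     (\<exists>\<alpha>\<^sub>1 \<alpha>\<^sub>2. class_Kinf \<alpha>\<^sub>1 \<and> class_Kinf \<alpha>\<^sub>2 \<and>
        (\<forall>x \<in> Pi_c H \<union> Pi_d H \<union> jump_map H ` jump_set H.
           \<alpha>\<^sub>1 (infdist x A) \<le> V x \<and> V x \<le> \<alpha>\<^sub>2 (infdist x A))) \<and>
     (\<forall>x \<in> Pi_c H.
        (INF u \<in> Psi_c H x. ereal (grad V x \<bullet> flow_map H (x, u))) \<le> ereal (- \<alpha>\<^sub>3 (infdist x A))) \<and>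
     (\<forall>x \<in> Pi_d H.
        (INF u \<in> Psi_d H x. ereal (V (jump_map H (x, u)))) - ereal (V x)
          \<le> ereal (- \<alpha>\<^sub>3 (infdist x A)))"

definition superlevel :: "('x \<Rightarrow> real) \<Rightarrow> real \<Rightarrow> 'x set" where
  "superlevel V r = {x. V x \<ge> r}"

definition Gamma_c ::
  "('n::finite, 'mc::finite, 'md::finite) hybrid_system \<Rightarrow> (real ^ 'n) set \<Rightarrow> (real ^ 'n \<Rightarrow> real)
     \<Rightarrow> (real \<Rightarrow> real) \<Rightarrow> real ^ 'n \<Rightarrow> real ^ 'mc \<Rightarrow> real \<Rightarrow> ereal" where
  "Gamma_c H A V \<alpha>\<^sub>3 x u r =
     (if (x, u) \<in> flow_set H \<inter> (superlevel V r \<times> UNIV)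
      then ereal (grad V x \<bullet> flow_map H (x, u) + \<alpha>\<^sub>3 (infdist x A)) else -\<infinity>)"

definition Gamma_d ::
  "('n::finite, 'mc::finite, 'md::finite) hybrid_system \<Rightarrow> (real ^ 'n) set \<Rightarrow> (real ^ 'n \<Rightarrow> real)
     \<Rightarrow> (real \<Rightarrow> real) \<Rightarrow> real ^ 'n \<Rightarrow> real ^ 'md \<Rightarrow> real \<Rightarrow> ereal" where
  "Gamma_d H A V \<alpha>\<^sub>3 x u r =
     (if (x, u) \<in> jump_set H \<inter> (superlevel V r \<times> UNIV)
      then ereal (V (jump_map H (x, u)) - V x + \<alpha>\<^sub>3 (infdist x A)) else -\<infinity>)"

definition S0_c ::
  "('n::finite, 'mc::finite, 'md::finite) hybrid_system \<Rightarrow> (real ^ 'n) set \<Rightarrow> (real ^ 'n \<Rightarrow> real)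
     \<Rightarrow> (real \<Rightarrow> real) \<Rightarrow> real ^ 'n \<Rightarrow> real \<Rightarrow> (real ^ 'mc) set" where
  "S0_c H A V \<alpha>\<^sub>3 x r =
     (if x \<in> Pi_c H \<inter> superlevel V r then {u \<in> U_c H. Gamma_c H A V \<alpha>\<^sub>3 x u r \<le> 0} else UNIV)"

definition S0_d ::
  "('n::finite, 'mc::finite, 'md::finite) hybrid_system \<Rightarrow> (real ^ 'n) set \<Rightarrow> (real ^ 'n \<Rightarrow> real)
     \<Rightarrow> (real \<Rightarrow> real) \<Rightarrow> real ^ 'n \<Rightarrow> real \<Rightarrow> (real ^ 'md) set" where
  "S0_d H A V \<alpha>\<^sub>3 x r =
     (if x \<in> Pi_d H \<inter> superlevel V r then {u \<in> U_d H. Gamma_d H A V \<alpha>\<^sub>3 x u r \<le> 0} else UNIV)"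

text \<open>Only \<open>r \<ge> 0\<close> is meaningful in \<open>S'\<close>. In \<open>T'\<close>, \<open>V x < 0\<close> can only happen where
  \<open>\<Psi> x\<close> is empty, so the value of \<open>S'\<close> for \<open>r < 0\<close> is immaterial.\<close>

definition S'_c ::
  "('n::finite, 'mc::finite, 'md::finite) hybrid_system \<Rightarrow> (real ^ 'n) set \<Rightarrow> (real ^ 'n \<Rightarrow> real)
     \<Rightarrow> (real \<Rightarrow> real) \<Rightarrow> (real ^ 'n \<Rightarrow> real ^ 'mc) \<Rightarrow> real ^ 'n \<Rightarrow> real \<Rightarrow> (real ^ 'mc) set" where
  "S'_c H A V \<alpha>\<^sub>3 \<rho>0 x r = (if r = 0 then {\<rho>0 x} else S0_c H A V \<alpha>\<^sub>3 x r)"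

definition S'_d ::
  "('n::finite, 'mc::finite, 'md::finite) hybrid_system \<Rightarrow> (real ^ 'n) set \<Rightarrow> (real ^ 'n \<Rightarrow> real)
     \<Rightarrow> (real \<Rightarrow> real) \<Rightarrow> (real ^ 'n \<Rightarrow> real ^ 'md) \<Rightarrow> real ^ 'n \<Rightarrow> real \<Rightarrow> (real ^ 'md) set" where
  "S'_d H A V \<alpha>\<^sub>3 \<rho>0 x r = (if r = 0 then {\<rho>0 x} else S0_d H A V \<alpha>\<^sub>3 x r)"

definition T'_c ::
  "('n::finite, 'mc::finite, 'md::finite) hybrid_system \<Rightarrow> (real ^ 'n) set \<Rightarrow> (real ^ 'n \<Rightarrow> real)
     \<Rightarrow> (real \<Rightarrow> real) \<Rightarrow> (real ^ 'n \<Rightarrow> real ^ 'mc) \<Rightarrow> real ^ 'n \<Rightarrow> (real ^ 'mc) set" where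
  "T'_c H A V \<alpha>\<^sub>3 \<rho>0 x = Psi_c H x \<inter> S'_c H A V \<alpha>\<^sub>3 \<rho>0 x (V x)"

definition T'_d ::
  "('n::finite, 'mc::finite, 'md::finite) hybrid_system \<Rightarrow> (real ^ 'n) set \<Rightarrow> (real ^ 'n \<Rightarrow> real)
     \<Rightarrow> (real \<Rightarrow> real) \<Rightarrow> (real ^ 'n \<Rightarrow> real ^ 'md) \<Rightarrow> real ^ 'n \<Rightarrow> (real ^ 'md) set" where
  "T'_d H A V \<alpha>\<^sub>3 \<rho>0 x = Psi_d H x \<inter> S'_d H A V \<alpha>\<^sub>3 \<rho>0 x (V x)"

section \<open>Hybrid arcs and solutions of systems without inputs\<close>

definition hybrid_time_domain :: "(real \<times> nat) set \<Rightarrow> bool" where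
  "hybrid_time_domain E \<longleftrightarrow> E \<subseteq> {0..} \<times> UNIV \<and>
     (\<forall>T J. (T, J) \<in> E \<longrightarrow>
        (\<exists>N t. t 0 = 0 \<and> (\<forall>j<N. t j \<le> t (Suc j)) \<and>
           E \<inter> ({0..T} \<times> {0..J}) = (\<Union>j<N. {t j..t (Suc j)} \<times> {j})))"

definition time_slice :: "(real \<times> nat) set \<Rightarrow> nat \<Rightarrow> real set" where
  "time_slice E j = {t. (t, j) \<in> E}"

text \<open>\<open>d division_of \<Union>d\<close> says that \<open>d\<close> is a finite family of non-overlapping compact intervals.\<close>

definition abs_continuous_on :: "real set \<Rightarrow> (real \<Rightarrow> 'a::real_normed_vector) \<Rightarrow> bool" where
  "abs_continuous_on I h \<longleftrightarrow>
     (\<forall>\<epsilon>>0. \<exists>\<delta>>0. \<forall>d. d division_of \<Union>d \<and> \<Union>d \<subseteq> I \<and> (\<Sum>k\<in>d. Sup k - Inf k) < \<delta> \<longrightarrow>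
        (\<Sum>k\<in>d. norm (h (Sup k) - h (Inf k))) < \<epsilon>)"

text \<open>The intervals of a hybrid time domain may be unbounded or half-open on the right;
  absolute continuity on them is meant on each compact subinterval, as usual for solutions of
  differential equations.\<close>

definition locally_abs_continuous_on :: "real set \<Rightarrow> (real \<Rightarrow> 'a::real_normed_vector) \<Rightarrow> bool" where
  "locally_abs_continuous_on I h \<longleftrightarrow> (\<forall>a b. {a..b} \<subseteq> I \<longrightarrow> abs_continuous_on {a..b} h)"

text \<open>Arguments: flow set \<open>C\<close>, flow map \<open>F\<close>, jump set \<open>D\<close>, jump map \<open>G\<close>. An arc is given by its
  domain \<open>E\<close> and a total function \<open>\<phi>\<close> whose values outside \<open>E\<close> are irrelevant. Solutions start in
  \<open>closure C \<union> D\<close>; without this requirement every point outside would carry a trivial maximal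
  solution.\<close>

definition is_solution ::
  "'a::euclidean_space set \<Rightarrow> ('a \<Rightarrow> 'a) \<Rightarrow> 'a set \<Rightarrow> ('a \<Rightarrow> 'a)
     \<Rightarrow> (real \<times> nat) set \<Rightarrow> (real \<Rightarrow> nat \<Rightarrow> 'a) \<Rightarrow> bool" where
  "is_solution C F D G E \<phi> \<longleftrightarrow>
     hybrid_time_domain E \<and>
     (\<forall>j. locally_abs_continuous_on (time_slice E j) (\<lambda>t. \<phi> t j)) \<and>
     (0, 0) \<in> E \<and> \<phi> 0 0 \<in> closure C \<union> D \<and>
     (\<forall>j. (\<forall>t \<in> interior (time_slice E j). \<phi> t j \<in> C) \<and>
          (AE t in lborel. t \<in> time_slice E j \<longrightarrow>
             ((\<lambda>s. \<phi> s j) has_vector_derivative F (\<phi> t j)) (at t within time_slice E j))) \<and>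
     (\<forall>t j. (t, j) \<in> E \<and> (t, Suc j) \<in> E \<longrightarrow> \<phi> t j \<in> D \<and> \<phi> t (Suc j) = G (\<phi> t j))"

definition is_maximal_solution ::
  "'a::euclidean_space set \<Rightarrow> ('a \<Rightarrow> 'a) \<Rightarrow> 'a set \<Rightarrow> ('a \<Rightarrow> 'a)
     \<Rightarrow> (real \<times> nat) set \<Rightarrow> (real \<Rightarrow> nat \<Rightarrow> 'a) \<Rightarrow> bool" where
  "is_maximal_solution C F D G E \<phi> \<longleftrightarrow>
     is_solution C F D G E \<phi> \<and>
     \<not> (\<exists>E' \<psi>. is_solution C F D G E' \<psi> \<and> E \<subset> E' \<and> (\<forall>(t, j)\<in>E. \<psi> t j = \<phi> t j))"

definition complete_domain :: "(real \<times> nat) set \<Rightarrow> bool" where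
  "complete_domain E \<longleftrightarrow> (\<forall>M. \<exists>(t, j)\<in>E. t + real j > M)"

definition inflation :: "'a::real_normed_vector set \<Rightarrow> real \<Rightarrow> 'a set" where
  "inflation K \<delta> = {x + \<delta> *\<^sub>R b |x b. x \<in> K \<and> b \<in> cball 0 1}"

definition globally_asymptotically_stable ::
  "'a::euclidean_space set \<Rightarrow> 'a set \<Rightarrow> ('a \<Rightarrow> 'a) \<Rightarrow> 'a set \<Rightarrow> ('a \<Rightarrow> 'a) \<Rightarrow> bool" where
  "globally_asymptotically_stable K C F D G \<longleftrightarrow>
     (\<forall>\<epsilon>>0. \<exists>\<delta>>0. \<forall>E \<phi>. is_maximal_solution C F D G E \<phi> \<and> \<phi> 0 0 \<in> inflation K \<delta> \<longrightarrow>
        (\<forall>(t, j)\<in>E. \<phi> t j \<in> inflation K \<epsilon>)) \<and>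
     (\<forall>E \<phi>. is_maximal_solution C F D G E \<phi> \<longrightarrow>
        bounded {\<phi> t j |t j. (t, j) \<in> E} \<and>
        (complete_domain E \<longrightarrow>
           (\<forall>\<epsilon>>0. \<exists>M. \<forall>(t, j)\<in>E. t + real j \<ge> M \<longrightarrow> infdist (\<phi> t j) K < \<epsilon>)))"

text \<open>The feedbacks are total functions regarded as having domains \<open>\<Pi>(C)\<close> and \<open>\<Pi>(D)\<close>.\<close>

definition renders_GAS ::
  "('n::finite, 'mc::finite, 'md::finite) hybrid_system \<Rightarrow> (real ^ 'n) set
     \<Rightarrow> (real ^ 'n \<Rightarrow> real ^ 'mc) \<Rightarrow> (real ^ 'n \<Rightarrow> real ^ 'md) \<Rightarrow> bool" where
  "renders_GAS H K \<rho>\<^sub>c \<rho>\<^sub>d \<longleftrightarrow>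
     globally_asymptotically_stable K
       {x \<in> Pi_c H. (x, \<rho>\<^sub>c x) \<in> flow_set H} (\<lambda>x. flow_map H (x, \<rho>\<^sub>c x))
       {x \<in> Pi_d H. (x, \<rho>\<^sub>d x) \<in> jump_set H} (\<lambda>x. jump_map H (x, \<rho>\<^sub>d x))"

end

theory Submission
  imports Defs
begin

text \<open>Asymptotic stability is a Lyapunov argument. On \<open>\<Pi>(C) \<union> \<Pi>(D) \<union> g(D)\<close> the function \<open>V\<close> is nonnegative
and vanishes exactly on \<open>A\<close>. At a point of the projections with \<open>V x > 0\<close>, the selected inputs belong to
the sets \<open>S\<^sup>\<circ>\<close>, which is the inequality \<open>\<langle>\<nabla>V, f\<rangle> \<le> - \<alpha>\<^sub>3\<close> for flows and \<open>V \<circ> g - V \<le> - \<alpha>\<^sub>3\<close>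
for jumps. At a point of \<open>A\<close>, the selected inputs are the nominal ones. A jump with the nominal input
stays in \<open>A\<close> because it is the first step of a maximal discrete solution
(\<open>maximal_discrete_solution\<close>). A flow stays in \<open>A\<close> because \<open>V\<close> would have to grow from zero
while its derivative is negative wherever \<open>V > 0\<close>.

So the closed loop meets the hypotheses of a hybrid Lyapunov theorem, the locale
\<open>hybrid_lyapunov\<close>. Its analytic core is that \<open>V\<close> along a flow arc is absolutely continuous, being a
Lipschitz function of an absolutely continuous one, and that an absolutely continuous function is
controlled by its almost everywhere derivative (\<open>abs_continuous_on_increment_le\<close>). Hence \<open>V\<close>
decreases along the path of flows and jumps from the initial point to any point of a hybrid
time domain, which yields stability and boundedness through \<open>\<alpha>\<^sub>1\<close> and \<open>\<alpha>\<^sub>2\<close>. As long as \<open>V\<close> stays above a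
positive level, it decreases at least linearly in \<open>t + j\<close>, which yields attractivity.

Continuity of the feedbacks is the continuity of minimal-norm selections of lower semicontinuous maps
with closed graph and convex values (\<open>min_norm_selection_continuous_at\<close>). Convexity of the
decrease constraint in the input makes the values convex where \<open>V > 0\<close>. On \<open>A\<close> the feedback is \<open>0\<close>,
and lower semicontinuity alone forces nearby selections to be small.\<close>

section \<open>Absolutely continuous functions\<close>

text \<open>The fundamental estimate for flows: an almost everywhere bound on the derivative of an absolutely
continuous function can be integrated. The proof is a Cousin (gauge) argument. Around a point with a
good derivative, the gauge is so fine that increments over small intervals are at most
\<open>c + e1\<close> times the length; around the points of the exceptional null set \<open>N\<close>, the
gauge stays inside an open set \<open>U \<supseteq> N\<close> of measure less than \<open>\<delta>\<close>. In a fine tagged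
division, the intervals tagged in \<open>N\<close> then have total length below \<open>\<delta>\<close>, so absolute continuity makes
their total increment small, and the other intervals give the bound.\<close>

lemma abs_continuous_on_increment_le:
  fixes h :: "real \<Rightarrow> real"
  assumes ac: "abs_continuous_on {a..b} h" and ab: "a \<le> b"
    and deriv: "AE t in lborel. t \<in> {a<..<b} \<longrightarrow>
                  (\<exists>l\<le>c. (h has_vector_derivative l) (at t))"
  shows "h b - h a \<le> c * (b - a)"
proof (rule field_le_epsilon)
  fix e :: real assume "e > 0"
  define e1 where "e1 = e / 2 / (b - a + 1)"
  have e1: "e1 > 0" and e1_le: "e1 * (b - a) \<le> e / 2"
    using \<open>e > 0\<close> ab by (auto simp: e1_def field_simps)
  define N where "N = {a..b} \<inter> {t. \<not> (t \<in> {a<..<b} \<and> (\<exists>l\<le>c. (h has_vector_derivative l) (at t)))}"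
  obtain \<delta>0 where "\<delta>0 > 0" and \<delta>0: "\<And>d. d division_of \<Union>d \<Longrightarrow> \<Union>d \<subseteq> {a..b} \<Longrightarrow> (\<Sum>k\<in>d. Sup k - Inf k) < \<delta>0
      \<Longrightarrow> (\<Sum>k\<in>d. norm (h (Sup k) - h (Inf k))) < e / 4"
    using ac[unfolded abs_continuous_on_def, rule_format, of "e / 4"] \<open>e > 0\<close> by auto
  \<comment> \<open>The second bound in \<open>\<delta>\<close> compensates, for negative \<open>c\<close>, the length that the intervals tagged in
    \<open>N\<close> take away from \<open>c * (b - a)\<close>.\<close>
  define k where "k = \<bar>c\<bar> + 1"
  have k: "\<bar>c\<bar> \<le> k" "k > 0" by (auto simp: k_def)
  define \<delta> where "\<delta> = min \<delta>0 (e / 4 / k)"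
  have "\<delta> > 0" "\<delta> \<le> \<delta>0" using \<open>\<delta>0 > 0\<close> \<open>e > 0\<close> k(2) by (auto simp: \<delta>_def)
  have c\<delta>: "\<bar>c\<bar> * \<delta> \<le> e / 4"
  proof -
    have "\<bar>c\<bar> * \<delta> \<le> k * (e / 4 / k)"
      using \<open>\<delta> > 0\<close> k by (intro mult_mono) (auto simp: \<delta>_def)
    then show ?thesis using k(2) by simp
  qed
  have "negligible N"
  proof -
    obtain M where M: "M \<in> null_sets lborel"
        "{t. \<not> (t \<in> {a<..<b} \<longrightarrow> (\<exists>l\<le>c. (h has_vector_derivative l) (at t)))} \<subseteq> M"
      using deriv by (auto simp: eventually_ae_filter)
    have "N \<subseteq> M \<union> {a, b}"
    proof
      fix t assume "t \<in> N"
      then show "t \<in> M \<union> {a, b}"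
        using M(2) by (cases "t = a \<or> t = b") (auto simp: N_def)
    qed
    moreover have "negligible M"
      using M(1) by (simp add: negligible_iff_null_sets null_sets_completionI)
    ultimately show ?thesis
      by (meson negligible_Un negligible_finite negligible_subset finite.intros)
  qed
  then have Nnull: "N \<in> null_sets lebesgue" by (simp add: negligible_iff_null_sets)
  obtain U where U: "open U" "N \<subseteq> U" "U - N \<in> lmeasurable" "emeasure lebesgue (U - N) < ennreal \<delta>"
    using sets_lebesgue_outer_open[OF _ \<open>\<delta> > 0\<close>, of N] Nnull by blast
  have Um: "U \<in> lmeasurable" "measure lebesgue U < \<delta>"
  proof -
    have U_eq: "U = (U - N) \<union> N" using U(2) by auto
    have "N \<in> lmeasurable" using \<open>negligible N\<close> negligible_iff_measure by blast
    then show "U \<in> lmeasurable" by (subst U_eq, intro fmeasurable.Un U(3))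
    have "measure lebesgue U = measure lebesgue (U - N)"
      using U(3) Nnull by (simp add: measure_Diff_null_set \<open>U \<in> lmeasurable\<close> fmeasurableD)
    also have "\<dots> < \<delta>"
      using U(3,4) \<open>\<delta> > 0\<close> by (simp add: emeasure_eq_measure2 ennreal_less_iff)
    finally show "measure lebesgue U < \<delta>" .
  qed
  have "\<exists>r>0. \<forall>u v. u \<le> t \<and> t \<le> v \<and> t - u < r \<and> v - t < r \<longrightarrow> h v - h u \<le> (c + e1) * (v - u)"
    if "t \<in> {a..b} - N" for t
  proof -
    obtain l where "l \<le> c" "(h has_vector_derivative l) (at t)"
      using \<open>t \<in> {a..b} - N\<close> by (auto simp: N_def)
    then obtain r where r: "r > 0" "\<And>y. \<bar>y - t\<bar> < r \<Longrightarrow> \<bar>h y - h t - (y - t) * l\<bar> \<le> e1 * \<bar>y - t\<bar>"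
      using e1 unfolding has_vector_derivative_def has_derivative_at_alt
      by (metis real_norm_def real_scaleR_def)
    have "h v - h u \<le> (c + e1) * (v - u)" if "u \<le> t" "t \<le> v" "t - u < r" "v - t < r" for u v
    proof -
      have "h v - h u \<le> (l + e1) * (v - u)"
      proof -
        have "\<bar>h u - h t - (u - t) * l\<bar> \<le> e1 * (t - u)" "\<bar>h v - h t - (v - t) * l\<bar> \<le> e1 * (v - t)"
          using r(2)[of u] r(2)[of v] that by auto
        then show ?thesis by (simp add: abs_le_iff algebra_simps)
      qed
      also have "\<dots> \<le> (c + e1) * (v - u)"
        using \<open>l \<le> c\<close> that by (intro mult_right_mono) auto
      finally show ?thesis .
    qed
    with \<open>r > 0\<close> show ?thesis by blast
  qed
  then obtain r where r: "\<And>t. t \<in> {a..b} - N \<Longrightarrow> r t > 0"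
    and incr: "\<And>t u v. t \<in> {a..b} - N \<Longrightarrow> u \<le> t \<Longrightarrow> t \<le> v \<Longrightarrow> t - u < r t \<Longrightarrow> v - t < r t
        \<Longrightarrow> h v - h u \<le> (c + e1) * (v - u)"
    by metis
  define g where "g t = (if t \<in> N then U else if t \<in> {a..b} then ball t (r t) else ball t 1)" for t
  have "gauge g"
    using U(1,2) r by (auto simp: gauge_def g_def)
  then obtain p where p: "p tagged_division_of {a..b}" "g fine p"
    using fine_division_exists_real by blast
  have fin: "finite p" using p(1) by blast
  define p1 where "p1 = {(t, K) \<in> p. t \<in> N}"
  define p2 where "p2 = {(t, K) \<in> p. t \<notin> N}"
  have split: "p = p1 \<union> p2" "p1 \<inter> p2 = {}" by (auto simp: p1_def p2_def)
  have inp: "\<exists>u v. K = {u..v} \<and> u \<le> t \<and> t \<le> v \<and> K \<subseteq> {a..b} \<and> K \<subseteq> g t" if "(t, K) \<in> p" for t K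
    using tagged_division_ofD(2-4)[OF p(1) that] fineD[OF p(2) that] by auto
  have telescope: "f b - f a = (\<Sum>(t, K)\<in>p1. f (Sup K) - f (Inf K)) + (\<Sum>(t, K)\<in>p2. f (Sup K) - f (Inf K))"
    for f :: "real \<Rightarrow> real"
    using additive_tagged_division_1[OF ab p(1), of f] fin split
    by (metis (no_types, lifting) finite_Un sum.union_disjoint)
  define L1 where "L1 = (\<Sum>(t, K)\<in>p1. Sup K - Inf K)"
  define L2 where "L2 = (\<Sum>(t, K)\<in>p2. Sup K - Inf K)"
  have L12: "b - a = L1 + L2" using telescope[of "\<lambda>t. t"] by (simp add: L1_def L2_def)
  have p1_le: "(\<Sum>(t, K)\<in>p1. h (Sup K) - h (Inf K)) \<le> e / 4" and L1: "0 \<le> L1" "L1 \<le> \<delta>"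
  proof -
    define d where "d = snd ` p1"
    have "p1 tagged_partial_division_of {a..b}"
      using p(1) split(1) by (meson Un_upper1 tagged_division_of_def tagged_partial_division_subset)
    then have p1: "p1 tagged_division_of \<Union>d"
      unfolding d_def by (rule tagged_partial_division_of_Union_self)
    then have div: "d division_of \<Union>d" unfolding d_def by (rule division_of_tagged_division)
    have dK: "\<exists>u v. K = {u..v} \<and> u \<le> v \<and> K \<subseteq> {a..b} \<and> K \<subseteq> U" if "K \<in> d" for K
    proof -
      obtain t where "(t, K) \<in> p" "t \<in> N" using \<open>K \<in> d\<close> by (auto simp: d_def p1_def)
      then show ?thesis using inp[of t K] by (auto simp: g_def)
    qed
    have to_d: "(\<Sum>(t, K)\<in>p1. norm (f (Sup K) - f (Inf K))) = (\<Sum>K\<in>d. norm (f (Sup K) - f (Inf K)))"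
      for f :: "real \<Rightarrow> real"
    proof -
      \<comment> \<open>\<open>Sup {}\<close> and \<open>Inf {}\<close> are unspecified reals, but the empty interval has to contribute zero.\<close>
      define F where "F K = (if K = {} then 0 else norm (f (Sup K) - f (Inf K)))" for K
      have "(\<Sum>(t, K)\<in>p1. norm (f (Sup K) - f (Inf K))) = (\<Sum>(t, K)\<in>p1. F K)"
        using inp split(1) by (intro sum.cong) (fastforce simp: F_def)+
      also have "\<dots> = sum F d"
        unfolding d_def
      proof (rule sum.over_tagged_division_lemma[OF p1])
        fix u v :: real
        assume "box u v = {}"
        then show "F (cbox u v) = 0"
          by (cases "u = v") (auto simp: F_def)
      qed
      also have "\<dots> = (\<Sum>K\<in>d. norm (f (Sup K) - f (Inf K)))"
        using dK by (intro sum.cong) (fastforce simp: F_def)+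
      finally show ?thesis .
    qed
    have "L1 = (\<Sum>(t, K)\<in>p1. norm (Sup K - Inf K))"
      unfolding L1_def using inp split(1) by (intro sum.cong) fastforce+
    also have "\<dots> = (\<Sum>K\<in>d. norm (Sup K - Inf K))" by (rule to_d)
    also have "\<dots> = (\<Sum>K\<in>d. Sup K - Inf K)"
      using dK by (intro sum.cong) fastforce+
    finally have L1_eq: "L1 = (\<Sum>K\<in>d. Sup K - Inf K)" .
    also have "\<dots> = (\<Sum>K\<in>d. measure lebesgue K)"
      using dK by (intro sum.cong) fastforce+
    also have "\<dots> = measure lebesgue (\<Union>d)" by (rule content_division[OF div])
    finally have L1_meas: "L1 = measure lebesgue (\<Union>d)" .
    also have "\<dots> \<le> measure lebesgue U"
    proof (rule measure_mono_fmeasurable)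
      show "\<Union>d \<subseteq> U" using dK by blast
      show "\<Union>d \<in> sets lebesgue" using lmeasurable_division[OF div] by (rule fmeasurableD)
    qed (rule Um(1))
    finally have "L1 < \<delta>" using Um(2) by simp
    then show "0 \<le> L1" "L1 \<le> \<delta>" using L1_meas by auto
    have "(\<Sum>K\<in>d. norm (h (Sup K) - h (Inf K))) < e / 4"
    proof (rule \<delta>0[OF div])
      show "\<Union>d \<subseteq> {a..b}" using dK by blast
    qed (use \<open>L1 < \<delta>\<close> \<open>\<delta> \<le> \<delta>0\<close> L1_eq in linarith)
    moreover have "(\<Sum>(t, K)\<in>p1. h (Sup K) - h (Inf K)) \<le> (\<Sum>(t, K)\<in>p1. norm (h (Sup K) - h (Inf K)))"
      by (intro sum_mono) auto
    ultimately show "(\<Sum>(t, K)\<in>p1. h (Sup K) - h (Inf K)) \<le> e / 4" using to_d[of h] by linarith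
  qed
  have "(\<Sum>(t, K)\<in>p2. h (Sup K) - h (Inf K)) \<le> (\<Sum>(t, K)\<in>p2. (c + e1) * (Sup K - Inf K))"
  proof (rule sum_mono, clarify)
    fix t K assume "(t, K) \<in> p2"
    then have tK: "(t, K) \<in> p" "t \<notin> N" by (auto simp: p2_def)
    obtain u v where uv: "K = {u..v}" "u \<le> t" "t \<le> v" "{u..v} \<subseteq> {a..b}" "{u..v} \<subseteq> g t"
      using inp[OF tK(1)] by blast
    then have t: "t \<in> {a..b} - N" using tK(2) by auto
    then have "g t = ball t (r t)" by (auto simp: g_def)
    moreover have "u \<in> {u..v}" "v \<in> {u..v}" using uv(2,3) by auto
    ultimately have "u \<in> ball t (r t)" "v \<in> ball t (r t)" using uv(5) by blast+
    then have "h v - h u \<le> (c + e1) * (v - u)"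
      using uv(2,3) by (intro incr[OF t]) (auto simp: dist_real_def)
    then show "h (Sup K) - h (Inf K) \<le> (c + e1) * (Sup K - Inf K)"
      using uv by simp
  qed
  also have "\<dots> = (c + e1) * L2"
    by (simp add: L2_def sum_distrib_left case_prod_unfold)
  finally have p2_le: "(\<Sum>(t, K)\<in>p2. h (Sup K) - h (Inf K)) \<le> (c + e1) * L2" .
  have "c * L2 \<le> c * (b - a) + e / 4"
  proof -
    have "c * L2 = c * (b - a) - c * L1" using L12 by (simp add: algebra_simps)
    moreover have "- (c * L1) \<le> \<bar>c\<bar> * L1" using L1(1) by (metis abs_ge_minus_self abs_mult abs_of_nonneg)
    moreover have "\<bar>c\<bar> * L1 \<le> \<bar>c\<bar> * \<delta>" using L1(2) by (intro mult_left_mono) auto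
    ultimately show ?thesis using c\<delta> by linarith
  qed
  moreover have "e1 * L2 \<le> e1 * (b - a)"
    using e1 L12 L1(1) by (intro mult_left_mono) auto
  ultimately show "h b - h a \<le> c * (b - a) + e"
    using telescope[of h] p1_le p2_le e1_le by (simp add: distrib_right)
qed

lemma abs_continuous_on_compose_lipschitz:
  assumes ac: "abs_continuous_on I \<phi>" and lip: "L-lipschitz_on (\<phi> ` I) V"
  shows "abs_continuous_on I (\<lambda>t. V (\<phi> t))"
  unfolding abs_continuous_on_def
proof (intro allI impI)
  fix e :: real assume "e > 0"
  have "L \<ge> 0" using lip by (rule lipschitz_on_nonneg)
  define k where "k = L + 1"
  have k: "L \<le> k" "k > 0" using \<open>L \<ge> 0\<close> by (auto simp: k_def)
  have "e / k > 0" using \<open>e > 0\<close> k by simp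
  then obtain \<delta> where "\<delta> > 0" and \<delta>: "\<And>d. d division_of \<Union>d \<Longrightarrow> \<Union>d \<subseteq> I \<Longrightarrow> (\<Sum>k\<in>d. Sup k - Inf k) < \<delta>
      \<Longrightarrow> (\<Sum>k\<in>d. norm (\<phi> (Sup k) - \<phi> (Inf k))) < e / k"
    using ac[unfolded abs_continuous_on_def, rule_format, OF \<open>e / k > 0\<close>] by blast
  have "(\<Sum>K\<in>d. norm (V (\<phi> (Sup K)) - V (\<phi> (Inf K)))) < e"
    if d: "d division_of \<Union>d" "\<Union>d \<subseteq> I" "(\<Sum>k\<in>d. Sup k - Inf k) < \<delta>" for d
  proof -
    have "(\<Sum>K\<in>d. norm (V (\<phi> (Sup K)) - V (\<phi> (Inf K)))) \<le> (\<Sum>K\<in>d. k * norm (\<phi> (Sup K) - \<phi> (Inf K)))"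
    proof (rule sum_mono)
      fix K assume "K \<in> d"
      then obtain u v where "K = {u..v}" "K \<noteq> {}" using division_ofD(3,4)[OF d(1)] by (metis box_real(2))
      then have "Sup K \<in> K" "Inf K \<in> K" by auto
      then have "Sup K \<in> I" "Inf K \<in> I" using \<open>K \<in> d\<close> d(2) by auto
      then have "norm (V (\<phi> (Sup K)) - V (\<phi> (Inf K))) \<le> L * norm (\<phi> (Sup K) - \<phi> (Inf K))"
        using lipschitz_onD[OF lip, of "\<phi> (Sup K)" "\<phi> (Inf K)"] by (simp add: dist_norm)
      also have "\<dots> \<le> k * norm (\<phi> (Sup K) - \<phi> (Inf K))" using k by (intro mult_right_mono) auto
      finally show "norm (V (\<phi> (Sup K)) - V (\<phi> (Inf K))) \<le> k * norm (\<phi> (Sup K) - \<phi> (Inf K))" .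
    qed
    also have "\<dots> = k * (\<Sum>K\<in>d. norm (\<phi> (Sup K) - \<phi> (Inf K)))" by (simp add: sum_distrib_left)
    also have "\<dots> < k * (e / k)" using \<delta>[OF d] k by (intro mult_strict_left_mono)
    finally show ?thesis using k by simp
  qed
  with \<open>\<delta> > 0\<close> show "\<exists>\<delta>>0. \<forall>d. d division_of \<Union>d \<and> \<Union>d \<subseteq> I \<and> (\<Sum>k\<in>d. Sup k - Inf k) < \<delta> \<longrightarrow>
      (\<Sum>k\<in>d. norm (V (\<phi> (Sup k)) - V (\<phi> (Inf k)))) < e"
    by blast
qed

lemma abs_continuous_on_imp_continuous_on:
  fixes \<phi> :: "real \<Rightarrow> 'a::real_normed_vector"
  assumes "abs_continuous_on {a..b} \<phi>"
  shows "continuous_on {a..b} \<phi>"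
proof (unfold continuous_on_iff, intro ballI allI impI)
  fix s e :: real assume s: "s \<in> {a..b}" and "e > 0"
  obtain \<delta> where "\<delta> > 0" and \<delta>: "\<And>d. d division_of \<Union>d \<Longrightarrow> \<Union>d \<subseteq> {a..b} \<Longrightarrow> (\<Sum>k\<in>d. Sup k - Inf k) < \<delta>
      \<Longrightarrow> (\<Sum>k\<in>d. norm (\<phi> (Sup k) - \<phi> (Inf k))) < e"
    using assms[unfolded abs_continuous_on_def, rule_format, OF \<open>e > 0\<close>] by blast
  have close: "norm (\<phi> v - \<phi> u) < e" if "u \<le> v" "v - u < \<delta>" "{u..v} \<subseteq> {a..b}" for u v
    using \<delta>[of "{{u..v}}"] that division_of_self[of u v] by (simp add: box_real)
  have "dist (\<phi> t) (\<phi> s) < e" if "t \<in> {a..b}" "dist t s < \<delta>" for t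
    using close[of s t] close[of t s] that s
    by (cases "s \<le> t") (auto simp: dist_norm norm_minus_commute)
  with \<open>\<delta> > 0\<close> show "\<exists>\<delta>>0. \<forall>t\<in>{a..b}. dist t s < \<delta> \<longrightarrow> dist (\<phi> t) (\<phi> s) < e" by blast
qed

text \<open>On the compact range of a flow arc, \<open>V\<close> is Lipschitz although this range need not be convex:
bounded gradients on small balls give local Lipschitz continuity, and compactness makes it uniform.\<close>

lemma C1_on_imp_lipschitz_on_compact:
  fixes V :: "'a::euclidean_space \<Rightarrow> real"
  assumes "C1_on X V" "open X" "compact K" "K \<subseteq> X"
  obtains L where "L-lipschitz_on K V"
proof -
  have "local_lipschitz {0::real} X (\<lambda>_. V)"
  proof (rule local_lipschitzI)
    fix t x assume "x \<in> X"
    then obtain r where r: "r > 0" "cball x r \<subseteq> X" using \<open>open X\<close> open_contains_cball by blast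
    then have "continuous_on (cball x r) (grad V)"
      using assms(1) continuous_on_subset by (auto simp: C1_on_def)
    then obtain B where B: "B > 0" "\<And>y. y \<in> cball x r \<Longrightarrow> norm (grad V y) \<le> B"
      using compact_continuous_image[OF _ compact_cball] compact_imp_bounded bounded_pos
      by (metis (no_types, lifting) image_eqI)
    have "B-lipschitz_on (cball x r) V"
    proof (rule bounded_derivative_imp_lipschitz)
      fix y assume y: "y \<in> cball x r"
      then have "GDERIV V y :> grad V y" using r assms(1) by (auto simp: C1_on_def)
      then show "(V has_derivative (\<lambda>h. h \<bullet> grad V y)) (at y within cball x r)"
        unfolding gderiv_def by (rule has_derivative_at_withinI)
      show "onorm (\<lambda>h. h \<bullet> grad V y) \<le> B"
      proof (rule onorm_bound)
        fix h :: 'a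
        have "norm (h \<bullet> grad V y) \<le> norm h * norm (grad V y)"
          by (simp add: Cauchy_Schwarz_ineq2)
        also have "\<dots> \<le> B * norm h" using B(2)[OF y] by (subst mult.commute) (intro mult_right_mono, auto)
        finally show "norm (h \<bullet> grad V y) \<le> B * norm h" .
      qed (use B in simp)
    qed (use B in auto)
    then have "\<forall>t\<in>cball t r \<inter> {0::real}. B-lipschitz_on (cball x r \<inter> X) V"
      by (auto intro: lipschitz_on_subset)
    with r show "\<exists>u>0. \<exists>L. \<forall>t\<in>cball t u \<inter> {0::real}. L-lipschitz_on (cball x u \<inter> X) V" by blast
  qed
  then have "local_lipschitz {0::real} K (\<lambda>_. V)"
    using local_lipschitz_subset[of _ _ "\<lambda>_. V" "{0}" K] assms(4) by blast
  then obtain L where "\<And>t::real. t \<in> {0} \<Longrightarrow> L-lipschitz_on K V"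
    using local_lipschitz_compact_implies_lipschitz[OF _ \<open>compact K\<close>, of "{0}" "\<lambda>_. V"] by auto
  then show thesis using that by blast
qed

section \<open>Hybrid time domains and solutions\<close>

text \<open>Every point \<open>(T, J)\<close> of a hybrid time domain is reached from \<open>(0, 0)\<close> by a path of flow intervals
\<open>[t j, t (j + 1)]\<close> and jumps inside the domain, and among the points \<open>(s, j)\<close> with \<open>s \<le> T\<close> and \<open>j \<le> J\<close> there are no others. The
defining condition only speaks about the part of \<open>E\<close> below a point, so \<open>E\<close> itself need not be
totally ordered: \<open>[0, 1] \<times> {0} \<union> {(1/2, 1)}\<close> satisfies it. All estimates are therefore made along the path
to one given point.\<close>

lemma hybrid_time_domain_path:
  assumes "hybrid_time_domain E" "(T, J) \<in> E"
  obtains t where "t 0 = 0" "t (Suc J) = T"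
    "\<And>j. j \<le> J \<Longrightarrow> t j \<le> t (Suc j)"
    "\<And>j. j \<le> J \<Longrightarrow> t (Suc j) \<le> T"
    "\<And>j s. j \<le> J \<Longrightarrow> s \<le> T \<Longrightarrow> (s, j) \<in> E \<longleftrightarrow> t j \<le> s \<and> s \<le> t (Suc j)"
proof -
  have E0: "E \<subseteq> {0..} \<times> UNIV" using assms(1) by (simp add: hybrid_time_domain_def)
  obtain N t where t0: "t 0 = 0" and mono: "\<And>j. j < N \<Longrightarrow> t j \<le> t (Suc j)"
    and E: "E \<inter> ({0..T} \<times> {0..J}) = (\<Union>j<N. {t j..t (Suc j)} \<times> {j})"
    using assms unfolding hybrid_time_domain_def by blast
  have "(T, J) \<in> E \<inter> ({0..T} \<times> {0..J})" using assms(2) E0 by auto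
  then have J: "J < N" "t J \<le> T" "T \<le> t (Suc J)" unfolding E by auto
  have iff: "(s, j) \<in> E \<longleftrightarrow> t j \<le> s \<and> s \<le> t (Suc j)" if "j \<le> J" "s \<le> T" for j s
  proof -
    have t_nonneg: "t i \<ge> 0" if "i \<le> N" for i
      using that
    proof (induction i)
      case (Suc i) then show ?case using mono[of i] by simp
    qed (simp add: t0)
    have "(s, j) \<in> E \<longleftrightarrow> (s, j) \<in> E \<inter> ({0..T} \<times> {0..J})"
      using that E0 by auto
    also have "\<dots> \<longleftrightarrow> t j \<le> s \<and> s \<le> t (Suc j)"
      unfolding E using that J by auto
    finally show ?thesis .
  qed
  have le: "t (Suc j) \<le> T" if "j \<le> J" for j
  proof -
    have "(t (Suc j), j) \<in> (\<Union>j<N. {t j..t (Suc j)} \<times> {j})"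
      using that J mono[of j] by auto
    then show ?thesis unfolding E[symmetric] by auto
  qed
  show thesis
    using that[of t] t0 J mono iff le le[of J] by force
qed

lemma hybrid_time_domain_slice_interval:
  assumes "hybrid_time_domain E" "(a, j) \<in> E" "(b, j) \<in> E"
  shows "{a..b} \<subseteq> time_slice E j"
proof
  fix s assume s: "s \<in> {a..b}"
  obtain t where "\<And>i s. i \<le> j \<Longrightarrow> s \<le> b \<Longrightarrow> (s, i) \<in> E \<longleftrightarrow> t i \<le> s \<and> s \<le> t (Suc i)"
    using hybrid_time_domain_path[OF assms(1,3)] by metis
  from this[of j a] this[of j b] this[of j s] show "s \<in> time_slice E j"
    using assms(2,3) s by (auto simp: time_slice_def)
qed

lemma hybrid_time_domain_pred:
  assumes "hybrid_time_domain E" "(s, Suc j) \<in> E"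
  obtains s' where "s' \<le> s" "(s', j) \<in> E" "(s', Suc j) \<in> E"
proof -
  obtain t where t: "\<And>i. i \<le> Suc j \<Longrightarrow> t i \<le> t (Suc i)" "\<And>i. i \<le> Suc j \<Longrightarrow> t (Suc i) \<le> s"
      "\<And>i r. i \<le> Suc j \<Longrightarrow> r \<le> s \<Longrightarrow> (r, i) \<in> E \<longleftrightarrow> t i \<le> r \<and> r \<le> t (Suc i)"
    using hybrid_time_domain_path[OF assms] by metis
  show thesis
    using that[of "t (Suc j)"] t(1)[of j] t(1)[of "Suc j"] t(2)[of j]
      t(3)[of j "t (Suc j)"] t(3)[of "Suc j" "t (Suc j)"] by simp
qed

text \<open>The induction along the path: a quantity that increases neither during flows nor at jumps is not larger
at \<open>(T, J)\<close> than at an earlier point. Both monotonicity hypotheses concern the part of the domain below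
\<open>(T, J)\<close>, so that the quantity may be chosen depending on \<open>(T, J)\<close>.\<close>

lemma hybrid_time_domain_nonincreasing:
  fixes W :: "real \<Rightarrow> nat \<Rightarrow> real"
  assumes E: "hybrid_time_domain E"
    and sk: "(s, k) \<in> E" "s \<le> T" "k \<le> J" and TJ: "(T, J) \<in> E"
    and flow: "\<And>a b j. j \<le> J \<Longrightarrow> a \<le> b \<Longrightarrow> b \<le> T \<Longrightarrow> (a, j) \<in> E \<Longrightarrow> (b, j) \<in> E \<Longrightarrow> W b j \<le> W a j"
    and jump: "\<And>t j. Suc j \<le> J \<Longrightarrow> t \<le> T \<Longrightarrow> (t, j) \<in> E \<Longrightarrow> (t, Suc j) \<in> E \<Longrightarrow> W t (Suc j) \<le> W t j"
  shows "W T J \<le> W s k"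
proof -
  obtain t where t: "t 0 = 0" "t (Suc J) = T"
    "\<And>j. j \<le> J \<Longrightarrow> t j \<le> t (Suc j)" "\<And>j. j \<le> J \<Longrightarrow> t (Suc j) \<le> T"
    and iff: "\<And>j s. j \<le> J \<Longrightarrow> s \<le> T \<Longrightarrow> (s, j) \<in> E \<longleftrightarrow> t j \<le> s \<and> s \<le> t (Suc j)"
    using hybrid_time_domain_path[OF E TJ] by metis
  have inE: "(t (Suc j), j) \<in> E" if "j \<le> J" for j
    using that t(3,4) by (simp add: iff)
  have "W (t (Suc j)) j \<le> W s k" if "k \<le> j" "j \<le> J" for j
    using that
  proof (induction j rule: dec_induct)
    case base
    show ?case using sk t(4) inE by (intro flow) (auto simp: iff)
  next
    case (step j)
    have inE': "(t (Suc j), Suc j) \<in> E" using step.prems t(3)[of "Suc j"] t(4)[of j] by (simp add: iff)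
    have "W (t (Suc (Suc j))) (Suc j) \<le> W (t (Suc j)) (Suc j)"
      using step.prems t(3)[of "Suc j"] t(4)[of "Suc j"] inE[of "Suc j"] inE' by (intro flow) auto
    also have "\<dots> \<le> W (t (Suc j)) j"
      using step.prems t(4)[of j] inE[of j] inE' by (intro jump) auto
    also have "\<dots> \<le> W s k" using step.IH step.prems by simp
    finally show ?case .
  qed
  from this[of J] sk(3) t(2) show ?thesis by simp
qed

text \<open>Absolute continuity closes the gap between the interior of a flow interval, where the state lies in the
flow set, and its end points, where it lies only in the closure.\<close>

lemma flow_in_closure:
  assumes sol: "is_solution C F D G E \<phi>" and ab: "(a, j) \<in> E" "(b, j) \<in> E" "a < b"
  shows "{a..b} \<subseteq> time_slice E j" "{a<..<b} \<subseteq> interior (time_slice E j)"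
    "abs_continuous_on {a..b} (\<lambda>t. \<phi> t j)" "(\<lambda>t. \<phi> t j) ` {a..b} \<subseteq> closure C"
proof -
  show slice: "{a..b} \<subseteq> time_slice E j"
    using hybrid_time_domain_slice_interval ab sol by (auto simp: is_solution_def)
  then show int: "{a<..<b} \<subseteq> interior (time_slice E j)"
    by (intro interior_maximal) auto
  show ac: "abs_continuous_on {a..b} (\<lambda>t. \<phi> t j)"
    using sol slice by (auto simp: is_solution_def locally_abs_continuous_on_def)
  have "(\<lambda>t. \<phi> t j) ` {a<..<b} \<subseteq> closure C"
    using sol int closure_subset by (fastforce simp: is_solution_def)
  then have "(\<lambda>t. \<phi> t j) ` closure {a<..<b} \<subseteq> closure C"
    using ab(3) abs_continuous_on_imp_continuous_on[OF ac]
    by (intro image_closure_subset) (auto simp: closure_greaterThanLessThan)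
  then show "(\<lambda>t. \<phi> t j) ` {a..b} \<subseteq> closure C"
    using ab(3) by (simp add: closure_greaterThanLessThan)
qed

text \<open>The points of the domain that belong to no proper flow interval are the initial point and those
reached by a jump.\<close>

lemma solution_range:
  assumes sol: "is_solution C F D G E \<phi>" and tj: "(t, j) \<in> E"
  shows "\<phi> t j \<in> closure C \<union> D \<union> G ` D"
proof (cases "\<exists>s. (s, j) \<in> E \<and> s \<noteq> t")
  case True
  then obtain s where s: "(s, j) \<in> E" "s \<noteq> t" by blast
  show ?thesis
  proof (cases "s < t")
    case True
    then have "t \<in> {s..t}" by simp
    then show ?thesis using flow_in_closure(4)[OF sol s(1) tj True] by blast
  next
    case False
    then have "t < s" "t \<in> {t..s}" using s(2) by auto
    then show ?thesis using flow_in_closure(4)[OF sol tj s(1)] by blast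
  qed
next
  case False
  then have only: "\<And>s. (s, j) \<in> E \<Longrightarrow> s = t" by blast
  show ?thesis
  proof (cases j)
    case 0
    then have "t = 0" using only[of 0] sol by (simp add: is_solution_def)
    then show ?thesis using sol 0 by (auto simp: is_solution_def)
  next
    case (Suc i)
    have "hybrid_time_domain E" using sol by (simp add: is_solution_def)
    then obtain s where "(s, i) \<in> E" "(s, Suc i) \<in> E"
      using hybrid_time_domain_pred tj unfolding Suc by metis
    moreover from this have "s = t" using only Suc by simp
    ultimately show ?thesis using sol Suc by (auto simp: is_solution_def)
  qed
qed

text \<open>With an empty flow set all flow intervals are degenerate, so ordinary time never advances.\<close>

lemma no_flow_time_zero:
  assumes sol: "is_solution {} F D G E \<phi>" and TJ: "(T, J) \<in> E"
  shows "T = 0"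
proof -
  have E: "hybrid_time_domain E" using sol by (simp add: is_solution_def)
  obtain t where t: "t 0 = 0" "t (Suc J) = T" "\<And>j. j \<le> J \<Longrightarrow> t j \<le> t (Suc j)"
      "\<And>j. j \<le> J \<Longrightarrow> t (Suc j) \<le> T"
    and iff: "\<And>j s. j \<le> J \<Longrightarrow> s \<le> T \<Longrightarrow> (s, j) \<in> E \<longleftrightarrow> t j \<le> s \<and> s \<le> t (Suc j)"
    using hybrid_time_domain_path[OF E TJ] by metis
  have "t (Suc j) = t j" if "j \<le> J" for j
  proof (rule ccontr)
    assume "t (Suc j) \<noteq> t j"
    then have lt: "t j < t (Suc j)" using t(3)[OF that] by simp
    have "{t j<..<t (Suc j)} \<subseteq> interior (time_slice E j)"
      using that t(4)[OF that] by (intro interior_maximal) (auto simp: time_slice_def iff)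
    moreover have "interior (time_slice E j) = {}" using sol by (auto simp: is_solution_def)
    ultimately show False using lt dense[OF lt] by auto
  qed
  then have "t j = 0" if "j \<le> Suc J" for j
    using that by (induction j) (auto simp: t(1))
  then show ?thesis using t(2) by auto
qed

text \<open>The maximal solution of a difference equation is the orbit of \<open>x\<close>, continued as long as it stays in
\<open>D\<close>. It serves to turn a hypothesis about all maximal solutions of a difference equation into a
statement about a single jump from \<open>x\<close>.\<close>

lemma maximal_discrete_solution:
  fixes x :: "'a::euclidean_space"
  assumes "x \<in> D"
  obtains E \<phi> where "is_maximal_solution {} F D G E \<phi>" "(0, Suc 0) \<in> E" "\<phi> 0 (Suc 0) = G x"
proof -
  define y where "y k = (G ^^ k) x" for k
  define E where "E = {0::real} \<times> {k. \<forall>i<k. y i \<in> D}"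
  define \<phi> where "\<phi> = (\<lambda>(t::real) k. y k)"
  have slice: "time_slice E j \<subseteq> {0}" for j by (auto simp: time_slice_def E_def)
  have dom: "hybrid_time_domain E"
    unfolding hybrid_time_domain_def
  proof (intro conjI allI impI)
    fix T J assume "(T, J) \<in> E"
    then show "\<exists>N t. t 0 = 0 \<and> (\<forall>j<N. t j \<le> t (Suc j)) \<and>
        E \<inter> ({0..T} \<times> {0..J}) = (\<Union>j<N. {t j..t (Suc j)} \<times> {j})"
      by (intro exI[of _ "Suc J"] exI[of _ "\<lambda>_. 0"]) (auto simp: E_def)
  qed (auto simp: E_def)
  have "interior (time_slice E j) = {}" for j
    using interior_mono[OF slice[of j]] by simp
  moreover have "AE t in lborel. t \<in> time_slice E j \<longrightarrow>
      ((\<lambda>s. \<phi> s j) has_vector_derivative F (\<phi> t j)) (at t within time_slice E j)" for j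
    using AE_lborel_singleton[of 0] slice[of j] by (auto elim!: eventually_mono)
  moreover have "locally_abs_continuous_on (time_slice E j) (\<lambda>t. \<phi> t j)" for j
    by (auto simp: \<phi>_def locally_abs_continuous_on_def abs_continuous_on_def intro: exI[of _ 1])
  ultimately have sol: "is_solution {} F D G E \<phi>"
    using dom assms by (auto simp: is_solution_def \<phi>_def E_def y_def)
  have "\<not> (E \<subset> E' \<and> (\<forall>(t, j)\<in>E. \<psi> t j = \<phi> t j))" if sol': "is_solution {} F D G E' \<psi>" for E' \<psi>
  proof
    assume ext: "E \<subset> E' \<and> (\<forall>(t, j)\<in>E. \<psi> t j = \<phi> t j)"
    then obtain t k where tk: "(t, k) \<in> E'" "(t, k) \<notin> E" by auto
    have "(0, k) \<in> E' \<longrightarrow> (0, k) \<in> E" for k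
    proof (induction k)
      case 0 then show ?case by (auto simp: E_def)
    next
      case (Suc k)
      show ?case
      proof
        assume "(0, Suc k) \<in> E'"
        moreover have "hybrid_time_domain E'" using sol' by (simp add: is_solution_def)
        ultimately obtain s where "(s, k) \<in> E'" by (metis hybrid_time_domain_pred)
        then have k: "(0, k) \<in> E'" using no_flow_time_zero[OF sol'] by metis
        then have "(0, k) \<in> E" using Suc.IH by simp
        moreover have "\<psi> 0 k \<in> D" using sol' k \<open>(0, Suc k) \<in> E'\<close> by (auto simp: is_solution_def)
        ultimately show "(0, Suc k) \<in> E" using ext by (auto simp: E_def \<phi>_def less_Suc_eq)
      qed
    qed
    then show False using tk no_flow_time_zero[OF sol' tk(1)] by blast
  qed
  then have "is_maximal_solution {} F D G E \<phi>"
    using sol by (auto simp: is_maximal_solution_def)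
  then show thesis using that[of E \<phi>] assms by (simp add: E_def \<phi>_def y_def)
qed

section \<open>Comparison functions and inflations\<close>

lemma class_Kinf_pos: "class_Kinf \<alpha> \<Longrightarrow> r > 0 \<Longrightarrow> \<alpha> r > 0"
  unfolding class_Kinf_def by (metis atLeast_iff order_less_imp_le order_refl strict_mono_onD)

lemma pos_def_fun_nonneg: "pos_def_fun \<alpha> \<Longrightarrow> s \<ge> 0 \<Longrightarrow> \<alpha> s \<ge> 0"
  unfolding pos_def_fun_def by (cases "s = 0") (auto simp: less_imp_le)

lemma pos_def_fun_bounded_below:
  assumes \<alpha>: "pos_def_fun \<alpha>" and a: "0 < a"
  obtains m where "m > 0" "\<And>s. a \<le> s \<Longrightarrow> s \<le> b \<Longrightarrow> m \<le> \<alpha> s"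
proof (cases "a \<le> b")
  case True
  have "continuous_on {a..b} \<alpha>"
    using \<alpha> a unfolding pos_def_fun_def by (auto elim: continuous_on_subset)
  then obtain s where "s \<in> {a..b}" "\<And>r. r \<in> {a..b} \<Longrightarrow> \<alpha> s \<le> \<alpha> r"
    using continuous_attains_inf[of "{a..b}" \<alpha>] True by auto
  then show ?thesis using that[of "\<alpha> s"] \<alpha> a by (auto simp: pos_def_fun_def)
qed (use that[of 1] in auto)

lemma infdist_le_if_in_inflation: "x \<in> inflation A \<delta> \<Longrightarrow> \<delta> \<ge> 0 \<Longrightarrow> infdist x A \<le> \<delta>"
proof -
  assume "x \<in> inflation A \<delta>" "\<delta> \<ge> 0"
  then obtain y b where y: "x = y + \<delta> *\<^sub>R b" "y \<in> A" "norm b \<le> 1" by (auto simp: inflation_def)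
  have "infdist x A \<le> dist x y" using y(2) by (rule infdist_le)
  also have "\<dots> \<le> \<delta>" using y \<open>\<delta> \<ge> 0\<close> by (simp add: dist_norm mult_left_le)
  finally show ?thesis .
qed

lemma in_inflation_if_infdist_le:
  fixes A :: "'a::euclidean_space set"
  assumes A: "closed A" "A \<noteq> {}" and x: "infdist x A \<le> \<delta>" "\<delta> > 0"
  shows "x \<in> inflation A \<delta>"
proof -
  obtain y where y: "y \<in> A" "infdist x A = dist x y"
    using infdist_attains_inf[OF A] by metis
  have "x = y + \<delta> *\<^sub>R ((x - y) /\<^sub>R \<delta>)" using x(2) by simp
  moreover have "norm ((x - y) /\<^sub>R \<delta>) \<le> 1"
    using x y by (simp add: dist_norm divide_inverse_commute[symmetric])
  ultimately show ?thesis using y(1) unfolding inflation_def mem_Collect_eq mem_cball_0 by blast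
qed

section \<open>Hybrid Lyapunov theorem\<close>

text \<open>The Lyapunov conditions for a hybrid system without inputs. The flow condition is imposed outside
\<open>A\<close> only: inside \<open>A\<close> the function \<open>V\<close> is at its minimum over \<open>closure C\<close>, so its derivative along a solution
vanishes wherever it exists, whatever the flow map is.\<close>

locale hybrid_lyapunov =
  fixes A C :: "'a::euclidean_space set" and F :: "'a \<Rightarrow> 'a" and D :: "'a set" and G :: "'a \<Rightarrow> 'a"
    and V :: "'a \<Rightarrow> real" and X :: "'a set" and \<alpha>\<^sub>1 \<alpha>\<^sub>2 \<alpha>\<^sub>3 :: "real \<Rightarrow> real"
  assumes A: "compact A" "A \<noteq> {}"
    and V_cont: "continuous_on UNIV V"
    and V_C1: "open X" "closure C \<subseteq> X" "C1_on X V"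
    and \<alpha>\<^sub>1: "class_Kinf \<alpha>\<^sub>1" and \<alpha>\<^sub>2: "class_Kinf \<alpha>\<^sub>2" and \<alpha>\<^sub>3: "pos_def_fun \<alpha>\<^sub>3"
    and V_bounds: "\<And>x. x \<in> C \<union> D \<union> G ` D \<Longrightarrow> \<alpha>\<^sub>1 (infdist x A) \<le> V x \<and> V x \<le> \<alpha>\<^sub>2 (infdist x A)"
    and V_flow: "\<And>x. x \<in> C - A \<Longrightarrow> grad V x \<bullet> F x \<le> - \<alpha>\<^sub>3 (infdist x A)"
    and V_jump: "\<And>x. x \<in> D \<Longrightarrow> V (G x) - V x \<le> - \<alpha>\<^sub>3 (infdist x A)"
begin

lemma V_bounds_closure:
  assumes "x \<in> closure C \<union> D \<union> G ` D"
  shows "\<alpha>\<^sub>1 (infdist x A) \<le> V x" "V x \<le> \<alpha>\<^sub>2 (infdist x A)"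
proof -
  have cont: "continuous_on UNIV (\<lambda>x. \<alpha> (infdist x A))" if "class_Kinf \<alpha>" for \<alpha>
    using that unfolding class_Kinf_def
    by (auto intro!: continuous_on_compose2[of "{0..}" \<alpha> UNIV "\<lambda>x. infdist x A"] continuous_intros
        simp: infdist_nonneg)
  have "closed {x. \<alpha>\<^sub>1 (infdist x A) \<le> V x \<and> V x \<le> \<alpha>\<^sub>2 (infdist x A)}"
    by (intro closed_Collect_conj closed_Collect_le cont \<alpha>\<^sub>1 \<alpha>\<^sub>2 V_cont)
  moreover have "C \<subseteq> {x. \<alpha>\<^sub>1 (infdist x A) \<le> V x \<and> V x \<le> \<alpha>\<^sub>2 (infdist x A)}"
    using V_bounds by auto
  ultimately have "closure C \<subseteq> {x. \<alpha>\<^sub>1 (infdist x A) \<le> V x \<and> V x \<le> \<alpha>\<^sub>2 (infdist x A)}"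
    by (rule closure_minimal[rotated])
  then show "\<alpha>\<^sub>1 (infdist x A) \<le> V x" "V x \<le> \<alpha>\<^sub>2 (infdist x A)"
    using assms V_bounds by auto
qed

lemma V_nonneg: "V x \<ge> 0" if "x \<in> closure C \<union> D \<union> G ` D"
proof -
  have "\<alpha>\<^sub>1 0 \<le> \<alpha>\<^sub>1 (infdist x A)"
    using \<alpha>\<^sub>1 unfolding class_Kinf_def
    by (intro mono_onD[of "{0..}" \<alpha>\<^sub>1] strict_mono_on_imp_mono_on) (auto simp: infdist_nonneg)
  then show ?thesis using V_bounds_closure(1)[OF that] \<alpha>\<^sub>1 by (simp add: class_Kinf_def)
qed

lemma V_zero_on_A: "V x = 0" if "x \<in> closure C \<union> D \<union> G ` D" "x \<in> A"
  using V_bounds_closure(2)[OF that(1)] V_nonneg[OF that(1)] that(2) \<alpha>\<^sub>2 by (simp add: class_Kinf_def)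

text \<open>The derivative of \<open>V\<close> along a flow arc is at most \<open>- \<alpha>\<^sub>3\<close> almost everywhere: outside \<open>A\<close> by the flow
condition, and at points of \<open>A\<close> because \<open>V\<close> has a minimum there, so that both the derivative and
\<open>\<alpha>\<^sub>3\<close> vanish. In particular a flow cannot leave \<open>A\<close>.\<close>

lemma V_decrease_flow:
  assumes sol: "is_solution C F D G E \<phi>" and ab: "(a, j) \<in> E" "(b, j) \<in> E" "a \<le> b"
    and m: "\<And>t. a < t \<Longrightarrow> t < b \<Longrightarrow> m \<le> \<alpha>\<^sub>3 (infdist (\<phi> t j) A)"
  shows "V (\<phi> b j) \<le> V (\<phi> a j) - m * (b - a)"
proof (cases "a = b")
  case False
  then have "a < b" using ab(3) by simp
  note slice = flow_in_closure[OF sol ab(1,2) \<open>a < b\<close>]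
  define h where "h t = V (\<phi> t j)" for t
  have "compact ((\<lambda>t. \<phi> t j) ` {a..b})"
    using abs_continuous_on_imp_continuous_on[OF slice(3)] by (rule compact_continuous_image) simp
  then obtain L where "L-lipschitz_on ((\<lambda>t. \<phi> t j) ` {a..b}) V"
    using C1_on_imp_lipschitz_on_compact[OF V_C1(3,1)] slice(4) V_C1(2) by (metis subset_trans)
  then have ac: "abs_continuous_on {a..b} h"
    unfolding h_def by (rule abs_continuous_on_compose_lipschitz[OF slice(3)])
  have "AE t in lborel. t \<in> time_slice E j \<longrightarrow>
      ((\<lambda>s. \<phi> s j) has_vector_derivative F (\<phi> t j)) (at t within time_slice E j)"
    using sol by (auto simp: is_solution_def)
  then have "AE t in lborel. t \<in> {a<..<b} \<longrightarrow> (\<exists>l\<le>- m. (h has_vector_derivative l) (at t))"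
  proof (eventually_elim, intro impI)
    fix t
    assume deriv: "t \<in> time_slice E j \<longrightarrow>
      ((\<lambda>s. \<phi> s j) has_vector_derivative F (\<phi> t j)) (at t within time_slice E j)"
      and t: "t \<in> {a<..<b}"
    have tint: "t \<in> interior (time_slice E j)" using slice(2) t by blast
    then have "t \<in> time_slice E j" using interior_subset by blast
    then have d\<phi>: "((\<lambda>s. \<phi> s j) has_vector_derivative F (\<phi> t j)) (at t)"
      using deriv at_within_interior[OF tint] by simp
    have inC: "\<phi> t j \<in> C" using sol tint by (auto simp: is_solution_def)
    then have "\<phi> t j \<in> closure C" using closure_subset by blast
    then have "GDERIV V (\<phi> t j) :> grad V (\<phi> t j)" using V_C1 by (auto simp: C1_on_def)
    then have dV: "(V has_derivative (\<lambda>h. h \<bullet> grad V (\<phi> t j))) (at (\<phi> t j))"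
      by (simp add: gderiv_def)
    define l where "l = grad V (\<phi> t j) \<bullet> F (\<phi> t j)"
    have "(h has_derivative (\<lambda>s. (s *\<^sub>R F (\<phi> t j)) \<bullet> grad V (\<phi> t j))) (at t)"
      unfolding h_def
      using has_derivative_compose[OF d\<phi>[unfolded has_vector_derivative_def] dV] .
    then have dh: "(h has_vector_derivative l) (at t)"
      by (simp add: has_vector_derivative_def l_def inner_commute)
    have "l \<le> - m"
    proof (cases "\<phi> t j \<in> A")
      case False
      then have "l \<le> - \<alpha>\<^sub>3 (infdist (\<phi> t j) A)" using V_flow inC by (auto simp: l_def)
      then show ?thesis using m[of t] t by auto
    next
      case True
      have "h t \<le> h s" if "\<bar>t - s\<bar> < min (t - a) (b - t)" for s
      proof -
        have "s \<in> {a..b}" using that by (auto simp: abs_if split: if_splits)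
        then have "\<phi> s j \<in> closure C" using slice(4) by blast
        then show ?thesis
          using V_nonneg[of "\<phi> s j"] V_zero_on_A[of "\<phi> t j"] True \<open>\<phi> t j \<in> closure C\<close> by (simp add: h_def)
      qed
      then have "l = 0"
        using dh t by (intro DERIV_local_min[of h l t "min (t - a) (b - t)"])
          (auto simp: has_real_derivative_iff_has_vector_derivative)
      moreover have "m \<le> 0" using m[of t] t True \<alpha>\<^sub>3 by (simp add: pos_def_fun_def)
      ultimately show ?thesis by simp
    qed
    with dh show "\<exists>l\<le>- m. (h has_vector_derivative l) (at t)" by blast
  qed
  then have "h b - h a \<le> - m * (b - a)"
    by (rule abs_continuous_on_increment_le[OF ac ab(3)])
  then show ?thesis by (simp add: h_def)
qed simp

lemma V_decrease_jump:
  assumes "is_solution C F D G E \<phi>" "(t, j) \<in> E" "(t, Suc j) \<in> E"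
  shows "V (\<phi> t (Suc j)) \<le> V (\<phi> t j) - \<alpha>\<^sub>3 (infdist (\<phi> t j) A)"
proof -
  have "\<phi> t j \<in> D" "\<phi> t (Suc j) = G (\<phi> t j)" using assms by (auto simp: is_solution_def)
  then show ?thesis using V_jump[of "\<phi> t j"] by simp
qed

lemma V_nonincreasing:
  assumes sol: "is_solution C F D G E \<phi>"
    and "(s, k) \<in> E" "s \<le> T" "k \<le> J" "(T, J) \<in> E"
  shows "V (\<phi> T J) \<le> V (\<phi> s k)"
proof (rule hybrid_time_domain_nonincreasing[OF _ assms(2-5)])
  show "hybrid_time_domain E" using sol by (simp add: is_solution_def)
  show "V (\<phi> b j) \<le> V (\<phi> a j)" if "a \<le> b" "(a, j) \<in> E" "(b, j) \<in> E" for a b j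
    using V_decrease_flow[OF sol that(2,3,1), of 0] pos_def_fun_nonneg[OF \<alpha>\<^sub>3 infdist_nonneg] by auto
  show "V (\<phi> t (Suc j)) \<le> V (\<phi> t j)" if "(t, j) \<in> E" "(t, Suc j) \<in> E" for t j
    using V_decrease_jump[OF sol that] pos_def_fun_nonneg[OF \<alpha>\<^sub>3 infdist_nonneg[of "\<phi> t j" A]]
    by linarith
qed

lemma V_le_initial:
  assumes sol: "is_solution C F D G E \<phi>" and "(t, j) \<in> E"
  shows "V (\<phi> t j) \<le> V (\<phi> 0 0)"
proof -
  have "0 \<le> t" using assms by (auto simp: is_solution_def hybrid_time_domain_def)
  then show ?thesis
    using assms by (intro V_nonincreasing[OF sol]) (auto simp: is_solution_def)
qed

text \<open>The lower bound \<open>m\<close> on the rate is assumed where \<open>V\<close> is at least its value at \<open>(T, J)\<close>; by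
monotonicity this covers the whole path to \<open>(T, J)\<close>. The proof applies monotonicity a second time,
to \<open>V + m (t + j)\<close>.\<close>

lemma V_le_linear:
  assumes sol: "is_solution C F D G E \<phi>" and TJ: "(T, J) \<in> E"
    and m: "\<And>t j. (t, j) \<in> E \<Longrightarrow> V (\<phi> T J) \<le> V (\<phi> t j) \<Longrightarrow> m \<le> \<alpha>\<^sub>3 (infdist (\<phi> t j) A)"
  shows "V (\<phi> T J) \<le> V (\<phi> 0 0) - m * (T + real J)"
proof -
  define W where "W t j = V (\<phi> t j) + m * (t + real j)" for t j
  have m': "m \<le> \<alpha>\<^sub>3 (infdist (\<phi> t j) A)" if "(t, j) \<in> E" "t \<le> T" "j \<le> J" for t j
    using V_nonincreasing[OF sol that TJ] m that(1) by blast
  have "0 \<le> T" using sol TJ by (auto simp: is_solution_def hybrid_time_domain_def)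
  have "W T J \<le> W 0 0"
  proof (rule hybrid_time_domain_nonincreasing[OF _ _ _ _ TJ])
    show "hybrid_time_domain E" "(0, 0) \<in> E" using sol by (simp_all add: is_solution_def)
    show "W b j \<le> W a j" if "j \<le> J" "a \<le> b" "b \<le> T" "(a, j) \<in> E" "(b, j) \<in> E" for a b j
    proof -
      have "{a..b} \<subseteq> time_slice E j"
        using sol that by (intro hybrid_time_domain_slice_interval) (auto simp: is_solution_def)
      then have "V (\<phi> b j) \<le> V (\<phi> a j) - m * (b - a)"
        using that by (intro V_decrease_flow[OF sol] m') (auto simp: time_slice_def subset_iff)
      then show ?thesis by (simp add: W_def algebra_simps)
    qed
    show "W t (Suc j) \<le> W t j" if "Suc j \<le> J" "t \<le> T" "(t, j) \<in> E" "(t, Suc j) \<in> E" for t j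
      using V_decrease_jump[OF sol that(3,4)] m'[OF that(3,2)] that(1) by (simp add: W_def algebra_simps)
  qed (use \<open>0 \<le> T\<close> in auto)
  then show ?thesis by (simp add: W_def)
qed

lemma infdist_less_if_V_less:
  assumes "x \<in> closure C \<union> D \<union> G ` D" "V x < \<alpha>\<^sub>1 r" "r \<ge> 0"
  shows "infdist x A < r"
proof (rule ccontr)
  assume "\<not> infdist x A < r"
  then have "\<alpha>\<^sub>1 r \<le> \<alpha>\<^sub>1 (infdist x A)"
    using \<alpha>\<^sub>1 assms(3) unfolding class_Kinf_def
    by (intro mono_onD[of "{0..}" \<alpha>\<^sub>1] strict_mono_on_imp_mono_on) auto
  then show False using V_bounds_closure(1)[OF assms(1)] assms(2) by linarith
qed

lemma V_small_near_A:
  assumes "c > 0"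
  obtains \<delta> where "\<delta> > 0" "\<And>x. x \<in> closure C \<union> D \<union> G ` D \<Longrightarrow> infdist x A \<le> \<delta> \<Longrightarrow> V x < c"
proof -
  have "continuous_on {0..} \<alpha>\<^sub>2" "\<alpha>\<^sub>2 0 = 0" using \<alpha>\<^sub>2 by (auto simp: class_Kinf_def)
  then obtain d where d: "d > 0" "\<And>s. s \<ge> 0 \<Longrightarrow> s < d \<Longrightarrow> \<bar>\<alpha>\<^sub>2 s\<bar> < c"
    using assms unfolding continuous_on_iff dist_real_def
    by (metis atLeast_iff abs_of_nonneg diff_zero order_refl)
  show thesis
  proof (rule that[of "d / 2"])
    fix x assume x: "x \<in> closure C \<union> D \<union> G ` D" "infdist x A \<le> d / 2"
    have "\<bar>\<alpha>\<^sub>2 (infdist x A)\<bar> < c" using d x(2) by (intro d(2)) (auto simp: infdist_nonneg)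
    then show "V x < c" using V_bounds_closure(2)[OF x(1)] by linarith
  qed (use d in simp)
qed

text \<open>If \<open>V \<ge> c\<close> at \<open>(T, J)\<close>, then the whole path to \<open>(T, J)\<close> stays in a compact range of distances away from
\<open>A\<close>, on which \<open>\<alpha>\<^sub>3\<close> has a positive minimum \<open>m\<close>; the linear decrease at rate \<open>m\<close> then bounds
\<open>T + J\<close>. The bound is uniform over the domain.\<close>

lemma V_eventually_small:
  assumes sol: "is_solution C F D G E \<phi>" and "c > 0"
  shows "\<exists>M. \<forall>(t, j)\<in>E. t + real j \<ge> M \<longrightarrow> V (\<phi> t j) < c"
proof -
  obtain a where a: "a > 0" "\<And>x. x \<in> closure C \<union> D \<union> G ` D \<Longrightarrow> infdist x A \<le> a \<Longrightarrow> V x < c"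
    using V_small_near_A[OF \<open>c > 0\<close>] by blast
  \<comment> \<open>While \<open>V \<ge> c\<close>, the distance to \<open>A\<close> is confined to \<open>[a, b]\<close>.\<close>
  obtain b where b: "b \<ge> 0" "V (\<phi> 0 0) < \<alpha>\<^sub>1 b" using \<alpha>\<^sub>1 by (auto simp: class_Kinf_def)
  obtain m where m: "m > 0" "\<And>s. a \<le> s \<Longrightarrow> s \<le> b \<Longrightarrow> m \<le> \<alpha>\<^sub>3 s"
    using pos_def_fun_bounded_below[OF \<alpha>\<^sub>3 a(1)] by metis
  have "V (\<phi> T J) < c" if TJ: "(T, J) \<in> E" "T + real J \<ge> V (\<phi> 0 0) / m" for T J
  proof (rule ccontr)
    assume c: "\<not> V (\<phi> T J) < c"
    have "V (\<phi> T J) \<le> V (\<phi> 0 0) - m * (T + real J)"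
    proof (rule V_le_linear[OF sol TJ(1)], rule m(2))
      fix t j assume tj: "(t, j) \<in> E" "V (\<phi> T J) \<le> V (\<phi> t j)"
      note range = solution_range[OF sol tj(1)]
      show "a \<le> infdist (\<phi> t j) A" using a(2)[OF range] tj(2) c by linarith
      show "infdist (\<phi> t j) A \<le> b"
        using infdist_less_if_V_less[OF range _ b(1)] V_le_initial[OF sol tj(1)] b(2) by linarith
    qed
    moreover have "V (\<phi> 0 0) \<le> m * (T + real J)" using TJ(2) m(1) by (simp add: field_simps)
    ultimately show False using c \<open>c > 0\<close> by linarith
  qed
  then show ?thesis by (intro exI[of _ "V (\<phi> 0 0) / m"]) auto
qed

theorem asymptotically_stable: "globally_asymptotically_stable A C F D G"
  unfolding globally_asymptotically_stable_def
proof (intro conjI allI impI)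
  fix e :: real assume "e > 0"
  then have "\<alpha>\<^sub>1 e > 0" by (rule class_Kinf_pos[OF \<alpha>\<^sub>1])
  then obtain \<delta> where \<delta>: "\<delta> > 0" "\<And>x. x \<in> closure C \<union> D \<union> G ` D \<Longrightarrow> infdist x A \<le> \<delta> \<Longrightarrow> V x < \<alpha>\<^sub>1 e"
    using V_small_near_A by metis
  have "\<phi> t j \<in> inflation A e"
    if sol: "is_solution C F D G E \<phi>" and init: "\<phi> 0 0 \<in> inflation A \<delta>" and tj: "(t, j) \<in> E" for E \<phi> t j
  proof -
    have "(0, 0) \<in> E" using sol by (simp add: is_solution_def)
    then have "V (\<phi> 0 0) < \<alpha>\<^sub>1 e"
      using \<delta>(1) by (intro \<delta>(2) solution_range[OF sol] infdist_le_if_in_inflation[OF init]) auto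
    then have "V (\<phi> t j) < \<alpha>\<^sub>1 e" using V_le_initial[OF sol tj] by linarith
    then show ?thesis
      using infdist_less_if_V_less[OF solution_range[OF sol tj]] \<open>e > 0\<close>
      by (intro in_inflation_if_infdist_le[OF compact_imp_closed[OF A(1)] A(2)]) (auto simp: less_imp_le)
  qed
  with \<delta>(1) show "\<exists>\<delta>>0. \<forall>E \<phi>. is_maximal_solution C F D G E \<phi> \<and> \<phi> 0 0 \<in> inflation A \<delta> \<longrightarrow>
      (\<forall>(t, j)\<in>E. \<phi> t j \<in> inflation A e)"
    unfolding is_maximal_solution_def by blast
next
  fix E \<phi> assume "is_maximal_solution C F D G E \<phi>"
  then have sol: "is_solution C F D G E \<phi>" by (simp add: is_maximal_solution_def)
  obtain b where b: "b \<ge> 0" "V (\<phi> 0 0) < \<alpha>\<^sub>1 b" using \<alpha>\<^sub>1 by (auto simp: class_Kinf_def)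
  obtain B where B: "\<And>y. y \<in> A \<Longrightarrow> norm y \<le> B"
    using compact_imp_bounded[OF A(1)] by (auto simp: bounded_iff)
  have "norm (\<phi> t j) \<le> B + b" if tj: "(t, j) \<in> E" for t j
  proof -
    have near: "infdist (\<phi> t j) A < b"
      using infdist_less_if_V_less[OF solution_range[OF sol tj] _ b(1)] V_le_initial[OF sol tj] b(2) by linarith
    obtain y where y: "y \<in> A" "infdist (\<phi> t j) A = dist (\<phi> t j) y"
      using infdist_attains_inf[OF compact_imp_closed[OF A(1)] A(2)] by metis
    have "norm (\<phi> t j) \<le> norm y + norm (\<phi> t j - y)"
      using norm_triangle_ineq[of y "\<phi> t j - y"] by simp
    then show ?thesis using B[OF y(1)] near y(2) by (simp add: dist_norm)
  qed
  then show "bounded {\<phi> t j |t j. (t, j) \<in> E}" by (auto simp: bounded_iff)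
next
  fix E \<phi> and e :: real assume "is_maximal_solution C F D G E \<phi>" "e > 0"
  then have sol: "is_solution C F D G E \<phi>" by (simp add: is_maximal_solution_def)
  obtain M where "\<And>t j. (t, j) \<in> E \<Longrightarrow> t + real j \<ge> M \<Longrightarrow> V (\<phi> t j) < \<alpha>\<^sub>1 e"
    using V_eventually_small[OF sol class_Kinf_pos[OF \<alpha>\<^sub>1 \<open>e > 0\<close>]] by auto
  then show "\<exists>M. \<forall>(t, j)\<in>E. t + real j \<ge> M \<longrightarrow> infdist (\<phi> t j) A < e"
    using infdist_less_if_V_less[OF solution_range[OF sol]] \<open>e > 0\<close> by (intro exI[of _ M]) auto
qed

end

section \<open>Minimal-norm selections\<close>

text \<open>By the parallelogram identity, the midpoint of two distinct elements of minimal norm would be shorter.\<close>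

lemma convex_min_norm_unique:
  fixes a b :: "'a::real_inner"
  assumes "convex T" "a \<in> T" "b \<in> T" "norm b \<le> norm a" and min: "\<And>u. u \<in> T \<Longrightarrow> norm a \<le> norm u"
  shows "a = b"
proof -
  have "(1 / 2) *\<^sub>R a + (1 / 2) *\<^sub>R b \<in> T" using assms by (intro convexD) auto
  then have "norm a \<le> norm ((1 / 2) *\<^sub>R (a + b))" using min by (simp add: scaleR_add_right)
  then have "2 * norm a \<le> norm (a + b)" by simp
  then have "(2 * norm a)\<^sup>2 \<le> (norm (a + b))\<^sup>2" by (intro power_mono) auto
  moreover have "(norm b)\<^sup>2 \<le> (norm a)\<^sup>2" using assms(4) by (intro power_mono) auto
  moreover have "(norm (a - b))\<^sup>2 = 2 * (norm a)\<^sup>2 + 2 * (norm b)\<^sup>2 - (norm (a + b))\<^sup>2"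
    by (simp add: power2_norm_eq_inner algebra_simps inner_commute)
  moreover have "(2 * norm a)\<^sup>2 = 4 * (norm a)\<^sup>2" by (simp add: power_mult_distrib)
  ultimately have "(norm (a - b))\<^sup>2 \<le> 0" by linarith
  then show ?thesis by simp
qed

text \<open>Minimal-norm selections of lower semicontinuous convex-valued maps with closed graph are continuous.
Along a sequence converging to \<open>x\<close>, lower semicontinuity supplies elements of \<open>T\<close> converging to
\<open>\<rho> x\<close>, so the selected elements are bounded and their cluster points have norm at most
\<open>norm (\<rho> x)\<close>; by closedness the cluster points lie in \<open>T x\<close>, and uniqueness identifies them with \<open>\<rho> x\<close>.
Closedness is stated for limits of such small norm; in this form it also holds where \<open>T x = {0}\<close>, even if
the graph of \<open>T\<close> is not closed there.\<close>

lemma min_norm_selection_continuous_at: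
  fixes T :: "'a::metric_space \<Rightarrow> 'b::euclidean_space set"
  assumes x: "x \<in> S" and sel: "\<And>y. y \<in> S \<Longrightarrow> is_arg_min norm (\<lambda>u. u \<in> T y) (\<rho> y)"
    and lsc: "lsc_at T x" and conv: "convex (T x)"
    and closed: "\<And>X Z z. X \<longlonglongrightarrow> x \<Longrightarrow> (\<And>i. X i \<in> S) \<Longrightarrow> (\<And>i. Z i \<in> T (X i)) \<Longrightarrow> Z \<longlonglongrightarrow> z
                  \<Longrightarrow> norm z \<le> norm (\<rho> x) \<Longrightarrow> z \<in> T x"
  shows "continuous (at x within S) \<rho>"
proof -
  have mem: "\<rho> y \<in> T y" and min: "\<And>u. u \<in> T y \<Longrightarrow> norm (\<rho> y) \<le> norm u" if "y \<in> S" for y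
    using sel[OF that] by (auto simp: is_arg_min_def not_less)
  have "(\<rho> \<circ> X) \<longlonglongrightarrow> \<rho> x" if X: "\<And>i. X i \<in> S" "X \<longlonglongrightarrow> x" for X
  proof (rule ccontr)
    assume "\<not> (\<rho> \<circ> X) \<longlonglongrightarrow> \<rho> x"
    then obtain e where "e > 0" and "\<exists>\<^sub>F i in sequentially. \<not> dist (\<rho> (X i)) (\<rho> x) < e"
      by (auto simp: tendsto_iff not_eventually)
    then have inf: "infinite {i. \<not> dist (\<rho> (X i)) (\<rho> x) < e}"
      by (simp add: frequently_cofinite cofinite_eq_sequentially[symmetric])
    define r where "r = enumerate {i. \<not> dist (\<rho> (X i)) (\<rho> x) < e}"
    have r: "strict_mono r" "\<And>i. \<not> dist (\<rho> (X (r i))) (\<rho> x) < e"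
      using strict_mono_enumerate[OF inf] enumerate_in_set[OF inf] by (auto simp: r_def)
    have "\<rho> x \<in> inner_limit T x" using lsc mem[OF x] by (auto simp: lsc_at_def)
    then obtain Z where Z: "Z \<longlonglongrightarrow> \<rho> x" "\<forall>\<^sub>F i in sequentially. Z i \<in> T (X i)"
      using X(2) by (auto simp: inner_limit_def)
    have le: "\<forall>\<^sub>F i in sequentially. norm (\<rho> (X i)) \<le> norm (Z i)"
      using Z(2) by eventually_elim (use min X(1) in auto)
    have "Bseq Z" using Z(1) convergentI convergent_imp_Bseq by blast
    then have "Bseq (\<lambda>i. \<rho> (X i))" by (rule Bseq_eventually_mono[OF le])
    then have "Bseq (\<lambda>i. \<rho> (X (r i)))" by (rule Bseq_subseq)
    then have "bounded (range (\<lambda>i. \<rho> (X (r i))))" by (simp add: Bseq_eq_bounded)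
    then obtain l q where q: "strict_mono q" "((\<lambda>i. \<rho> (X (r i))) \<circ> q) \<longlonglongrightarrow> l"
      using bounded_imp_convergent_subsequence by blast
    define p where "p i = r (q i)" for i
    have p: "strict_mono p" using r(1) q(1) by (simp add: p_def strict_mono_def)
    have lim: "(\<lambda>i. \<rho> (X (p i))) \<longlonglongrightarrow> l" using q(2) by (simp add: p_def comp_def)
    have "norm l \<le> norm (\<rho> x)"
    proof (rule tendsto_le)
      show "(\<lambda>i. norm (Z (p i))) \<longlonglongrightarrow> norm (\<rho> x)"
        using LIMSEQ_subseq_LIMSEQ[OF Z(1) p] by (intro tendsto_norm) (simp add: comp_def)
      show "(\<lambda>i. norm (\<rho> (X (p i)))) \<longlonglongrightarrow> norm l" by (intro tendsto_norm lim)
      show "\<forall>\<^sub>F i in sequentially. norm (\<rho> (X (p i))) \<le> norm (Z (p i))"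
        using le p by (rule eventually_subseq[rotated])
    qed simp
    moreover from this have "l \<in> T x"
      using X LIMSEQ_subseq_LIMSEQ[OF X(2) p] mem lim
      by (intro closed[of "X \<circ> p" "\<lambda>i. \<rho> (X (p i))"]) auto
    ultimately have "\<rho> x = l"
      by (intro convex_min_norm_unique[OF conv mem[OF x]] min[OF x])
    then have "\<forall>\<^sub>F i in sequentially. dist (\<rho> (X (p i))) (\<rho> x) < e"
      using lim \<open>e > 0\<close> by (simp add: tendsto_iff)
    then show False using r(2) by (simp add: p_def)
  qed
  then show ?thesis by (auto simp: continuous_within_sequentially)
qed

text \<open>The common form of the flow and the jump feedback. Where \<open>V x \<noteq> 0\<close>, the decrease constraint
\<open>\<gamma> x u \<le> 0\<close> is closed and the same formula for \<open>T\<close> holds nearby. Where \<open>V x = 0\<close>, the formula may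
change in every neighbourhood, but there \<open>T x = {0}\<close>.\<close>

lemma min_norm_feedback_continuous:
  fixes \<Psi> T :: "'a::euclidean_space \<Rightarrow> 'b::euclidean_space set" and V :: "'a \<Rightarrow> real"
    and \<gamma> :: "'a \<Rightarrow> 'b \<Rightarrow> real"
  assumes T: "\<And>x. x \<in> P \<Longrightarrow> T x = (if V x = 0 then \<Psi> x \<inter> {0} else {u \<in> \<Psi> x. \<gamma> x u \<le> 0})"
    and V: "continuous_on UNIV V" and \<Psi>: "has_closed_graph \<Psi>"
    and \<gamma>: "continuous_on (X \<times> UNIV) (\<lambda>(x, u). \<gamma> x u)" "P \<subseteq> X"
    and conv: "\<And>x. x \<in> P \<Longrightarrow> V x \<noteq> 0 \<Longrightarrow> convex (T x)"
    and lsc: "\<And>x. x \<in> P \<Longrightarrow> lsc_at T x"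
    and sel: "\<And>x. x \<in> P \<Longrightarrow> is_arg_min norm (\<lambda>u. u \<in> T x) (\<rho> x)"
  shows "continuous_on P \<rho>"
  unfolding continuous_on_eq_continuous_within
proof
  fix x assume x: "x \<in> P"
  show "continuous (at x within P) \<rho>"
  proof (rule min_norm_selection_continuous_at[OF x sel lsc[OF x]])
    have mem: "\<rho> x \<in> T x" using sel[OF x] by (simp add: is_arg_min_def)
    have T0: "T x = {0}" if "V x = 0"
    proof -
      have eq: "T x = \<Psi> x \<inter> {0}" using T[OF x] that by simp
      have "\<rho> x \<in> \<Psi> x" "\<rho> x = 0" using mem[unfolded eq] by blast+
      then have "0 \<in> \<Psi> x" by metis
      then show ?thesis unfolding eq by simp
    qed
    show "convex (T x)"
    proof (cases "V x = 0")
      case True then show ?thesis using T0 by simp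
    qed (rule conv[OF x])
    fix Y :: "nat \<Rightarrow> 'a" and Z z
    assume Y: "Y \<longlonglongrightarrow> x" "\<And>i. Y i \<in> P" and Z: "\<And>i. Z i \<in> T (Y i)" "Z \<longlonglongrightarrow> z"
      and z: "norm z \<le> norm (\<rho> x)"
    show "z \<in> T x"
    proof (cases "V x = 0")
      case True
      then have "T x = {0}" by (rule T0)
      moreover from this have "z = 0" using mem z by simp
      ultimately show ?thesis by simp
    next
      case False
      have "(\<lambda>i. V (Y i)) \<longlonglongrightarrow> V x"
        using V Y(1) by (intro continuous_on_tendsto_compose[OF V]) auto
      then have "\<forall>\<^sub>F i in sequentially. V (Y i) \<noteq> 0"
        using False by (rule tendsto_imp_eventually_ne)
      then have le: "\<forall>\<^sub>F i in sequentially. \<gamma> (Y i) (Z i) \<le> 0"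
      proof eventually_elim
        case (elim i)
        then show ?case using Z(1)[of i] T[OF Y(2)[of i]] by simp
      qed
      have lim: "(\<lambda>i. (Y i, Z i)) \<longlonglongrightarrow> (x, z)" by (intro tendsto_Pair Y Z)
      have "(x, z) \<in> {(x, u). u \<in> \<Psi> x}"
        using \<Psi>[unfolded has_closed_graph_def] _ lim
      proof (rule closed_sequentially)
        show "(Y i, Z i) \<in> {(x, u). u \<in> \<Psi> x}" for i
        proof -
          have "T (Y i) \<subseteq> \<Psi> (Y i)" using T[OF Y(2)[of i]] by simp
          then show ?thesis using Z(1)[of i] by blast
        qed
      qed
      moreover have "(\<lambda>i. (\<lambda>(x, u). \<gamma> x u) (Y i, Z i)) \<longlonglongrightarrow> (\<lambda>(x, u). \<gamma> x u) (x, z)"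
        using lim x Y(2)[THEN subsetD[OF \<gamma>(2)]] \<gamma>(2)
        by (intro continuous_on_tendsto_compose[OF \<gamma>(1)]) auto
      then have "\<gamma> x z \<le> 0"
        using tendsto_upperbound[OF _ le] by simp
      ultimately show ?thesis using T[OF x] False by simp
    qed
  qed
qed

lemma convex_sublevel_if_ereal_convex_on:
  assumes "ereal_convex_on S h" and h: "\<And>u. u \<in> S \<Longrightarrow> h u = ereal (\<gamma> u)"
  shows "convex {u \<in> S. \<gamma> u \<le> 0}"
proof (rule convexI)
  fix u v and a b :: real
  assume uv: "u \<in> {u \<in> S. \<gamma> u \<le> 0}" "v \<in> {u \<in> S. \<gamma> u \<le> 0}" and ab: "0 \<le> a" "0 \<le> b" "a + b = 1"
  have a: "a = 1 - b" and b: "b \<in> {0..1}" using ab by auto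
  have S: "a *\<^sub>R u + b *\<^sub>R v \<in> S"
    using assms(1) uv ab by (auto simp: ereal_convex_on_def convex_def)
  have "h (a *\<^sub>R u + b *\<^sub>R v) \<le> ereal a * h u + ereal b * h v"
    using assms(1) uv b unfolding ereal_convex_on_def a by blast
  then have "\<gamma> (a *\<^sub>R u + b *\<^sub>R v) \<le> a * \<gamma> u + b * \<gamma> v"
    using uv S by (simp add: h)
  also have "\<dots> \<le> 0" using uv ab by (simp add: mult_nonneg_nonpos add_nonpos_nonpos)
  finally show "a *\<^sub>R u + b *\<^sub>R v \<in> {u \<in> S. \<gamma> u \<le> 0}" using S by simp
qed

section \<open>Stabilization by the minimal-norm feedback\<close>

text \<open>For points of the projections, the case distinctions in the definition of the regulation maps reduce to
one: on the zero set of \<open>V\<close> the nominal input, elsewhere the inputs with sufficient decrease.\<close>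

lemma T'_c_eq:
  assumes HBC: "hybrid_basic_conditions H" and x: "x \<in> Pi_c H"
  shows "T'_c H A V \<alpha>\<^sub>3 \<rho>0 x =
    (if V x = 0 then Psi_c H x \<inter> {\<rho>0 x}
     else {u \<in> Psi_c H x. grad V x \<bullet> flow_map H (x, u) + \<alpha>\<^sub>3 (infdist x A) \<le> 0})"
proof -
  have "Psi_c H x \<subseteq> U_c H"
    using HBC closedin_imp_subset by (fastforce simp: hybrid_basic_conditions_def Psi_c_def)
  then show ?thesis
    using x by (auto simp: T'_c_def S'_c_def S0_c_def Gamma_c_def superlevel_def Psi_c_def)
qed

lemma T'_d_eq:
  assumes HBC: "hybrid_basic_conditions H" and x: "x \<in> Pi_d H"
  shows "T'_d H A V \<alpha>\<^sub>3 \<rho>0 x =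
    (if V x = 0 then Psi_d H x \<inter> {\<rho>0 x}
     else {u \<in> Psi_d H x. V (jump_map H (x, u)) - V x + \<alpha>\<^sub>3 (infdist x A) \<le> 0})"
proof -
  have "Psi_d H x \<subseteq> U_d H"
    using HBC closedin_imp_subset by (fastforce simp: hybrid_basic_conditions_def Psi_d_def)
  then show ?thesis
    using x by (auto simp: T'_d_def S'_d_def S0_d_def Gamma_d_def superlevel_def Psi_d_def)
qed

theorem theorem3p5:
  fixes H :: "('n::finite, 'mc::finite, 'md::finite) hybrid_system"
    and A :: "(real ^ 'n) set"
    and V :: "real ^ 'n \<Rightarrow> real"
    and \<alpha>\<^sub>3 :: "real \<Rightarrow> real"
    and \<rho>\<^sub>c\<^sub>0 \<rho>\<^sub>c :: "real ^ 'n \<Rightarrow> real ^ 'mc"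
    and \<rho>\<^sub>d\<^sub>0 \<rho>\<^sub>d :: "real ^ 'n \<Rightarrow> real ^ 'md"
  assumes A: "compact A" "A \<noteq> {}"
    and HBC: "hybrid_basic_conditions H"
    and CLF: "CLF_with H A V \<alpha>\<^sub>3"
    and M1: "lsc (Psi_c H)" "lsc (Psi_d H)"
      "\<forall>x. convex (Psi_c H x)" "\<forall>x. convex (Psi_d H x)"
    and M2: "\<forall>r>0. \<forall>x \<in> Pi_c H \<inter> superlevel V r.
               ereal_convex_on (Psi_c H x) (\<lambda>u. Gamma_c H A V \<alpha>\<^sub>3 x u r)"
      "\<forall>r>0. \<forall>x \<in> Pi_d H \<inter> superlevel V r.
               ereal_convex_on (Psi_d H x) (\<lambda>u. Gamma_d H A V \<alpha>\<^sub>3 x u r)"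
    and nominal: "\<forall>x. \<rho>\<^sub>c\<^sub>0 x \<in> U_c H" "\<forall>x. \<rho>\<^sub>d\<^sub>0 x \<in> U_d H"
    and M3: "\<forall>E \<phi>. is_maximal_solution (Pi_c H \<inter> A) (\<lambda>x. flow_map H (x, \<rho>\<^sub>c\<^sub>0 x)) {} id E \<phi> \<longrightarrow>
               (\<forall>t. (t, 0) \<in> E \<longrightarrow> infdist (\<phi> t 0) A = 0)"
    and M4: "\<forall>E \<phi>. is_maximal_solution {} id (Pi_d H \<inter> A) (\<lambda>x. jump_map H (x, \<rho>\<^sub>d\<^sub>0 x)) E \<phi> \<longrightarrow>
               (\<forall>j. (0, j) \<in> E \<longrightarrow> infdist (\<phi> 0 j) A = 0)"
    and M5: "\<forall>x \<in> Pi_c H \<inter> superlevel V 0. lsc_at (T'_c H A V \<alpha>\<^sub>3 \<rho>\<^sub>c\<^sub>0) x"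
    and M6: "\<forall>x \<in> Pi_d H \<inter> superlevel V 0. lsc_at (T'_d H A V \<alpha>\<^sub>3 \<rho>\<^sub>d\<^sub>0) x"
    and rho_c: "\<forall>x \<in> Pi_c H. is_arg_min norm (\<lambda>u. u \<in> T'_c H A V \<alpha>\<^sub>3 \<rho>\<^sub>c\<^sub>0 x) (\<rho>\<^sub>c x)"
    and rho_d: "\<forall>x \<in> Pi_d H. is_arg_min norm (\<lambda>u. u \<in> T'_d H A V \<alpha>\<^sub>3 \<rho>\<^sub>d\<^sub>0 x) (\<rho>\<^sub>d x)"
  shows "renders_GAS H A \<rho>\<^sub>c \<rho>\<^sub>d \<and>
    (has_closed_graph (Psi_c H) \<and> has_closed_graph (Psi_d H) \<and>
       (\<forall>x\<in>A. \<rho>\<^sub>c\<^sub>0 x = 0) \<and> (\<forall>x\<in>A. \<rho>\<^sub>d\<^sub>0 x = 0) \<longrightarrow>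
     continuous_on (Pi_c H) \<rho>\<^sub>c \<and> continuous_on (Pi_d H) \<rho>\<^sub>d)"
proof (intro conjI impI)
  obtain X where X: "open X" "closure (Pi_c H) \<subseteq> X" "C1_on X V"
    using CLF by (auto simp: CLF_with_def)
  have V: "continuous_on UNIV V" and \<alpha>\<^sub>3: "pos_def_fun \<alpha>\<^sub>3" using CLF by (auto simp: CLF_with_def)
  obtain \<alpha>\<^sub>1 \<alpha>\<^sub>2 where \<alpha>: "class_Kinf \<alpha>\<^sub>1" "class_Kinf \<alpha>\<^sub>2"
    and bounds: "\<And>x. x \<in> Pi_c H \<union> Pi_d H \<union> jump_map H ` jump_set H \<Longrightarrow>
      \<alpha>\<^sub>1 (infdist x A) \<le> V x \<and> V x \<le> \<alpha>\<^sub>2 (infdist x A)"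
    using CLF unfolding CLF_with_def by blast
  have V_nonneg: "V x \<ge> 0" and V_zero: "V x = 0 \<longleftrightarrow> x \<in> A"
    if x: "x \<in> Pi_c H \<union> Pi_d H \<union> jump_map H ` jump_set H" for x
  proof -
    have \<alpha>0: "\<alpha>\<^sub>1 0 = 0" "\<alpha>\<^sub>2 0 = 0" "strict_mono_on {0..} \<alpha>\<^sub>1" using \<alpha> by (auto simp: class_Kinf_def)
    have pos: "\<alpha>\<^sub>1 (infdist x A) > 0" if "x \<notin> A"
    proof -
      have "infdist x A > 0"
        using that A by (meson compact_imp_closed infdist_pos_not_in_closed)
      then show ?thesis using strict_mono_onD[OF \<alpha>0(3), of 0 "infdist x A"] \<alpha>0(1) by simp
    qed
    show "V x \<ge> 0" "V x = 0 \<longleftrightarrow> x \<in> A"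
      using bounds[OF x] pos \<alpha>0 by (cases "x \<in> A"; force)+
  qed
  have c_mem: "\<rho>\<^sub>c x \<in> T'_c H A V \<alpha>\<^sub>3 \<rho>\<^sub>c\<^sub>0 x" if "x \<in> Pi_c H" for x
    using rho_c that by (auto simp: is_arg_min_def)
  have d_mem: "\<rho>\<^sub>d x \<in> T'_d H A V \<alpha>\<^sub>3 \<rho>\<^sub>d\<^sub>0 x" if "x \<in> Pi_d H" for x
    using rho_d that by (auto simp: is_arg_min_def)
  have d_feasible: "(x, \<rho>\<^sub>d x) \<in> jump_set H" if "x \<in> Pi_d H" for x
    using d_mem[OF that] by (auto simp: T'_d_def Psi_d_def)
  have flow: "grad V x \<bullet> flow_map H (x, \<rho>\<^sub>c x) \<le> - \<alpha>\<^sub>3 (infdist x A)" if "x \<in> Pi_c H - A" for x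
    using c_mem[of x] V_zero[of x] that by (simp add: T'_c_eq[OF HBC])
  have jump: "V (jump_map H (x, \<rho>\<^sub>d x)) - V x \<le> - \<alpha>\<^sub>3 (infdist x A)" if x: "x \<in> Pi_d H" for x
  proof (cases "x \<in> A")
    case False
    then show ?thesis using d_mem[OF x] V_zero[of x] x by (simp add: T'_d_eq[OF HBC])
  next
    case True
    then have "V x = 0" using V_zero[of x] x by simp
    then have \<rho>: "\<rho>\<^sub>d x = \<rho>\<^sub>d\<^sub>0 x" using d_mem[OF x] x by (simp add: T'_d_eq[OF HBC])
    \<comment> \<open>In \<open>A\<close> the feedback agrees with the nominal one, whose discrete orbit does not leave \<open>A\<close>.\<close>
    obtain E \<phi> where sol: "is_maximal_solution {} id (Pi_d H \<inter> A) (\<lambda>x. jump_map H (x, \<rho>\<^sub>d\<^sub>0 x)) E \<phi>"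
        "(0, Suc 0) \<in> E" "\<phi> 0 (Suc 0) = jump_map H (x, \<rho>\<^sub>d\<^sub>0 x)"
      using maximal_discrete_solution[of x "Pi_d H \<inter> A" id "\<lambda>x. jump_map H (x, \<rho>\<^sub>d\<^sub>0 x)"] True x by blast
    then have "infdist (jump_map H (x, \<rho>\<^sub>d x)) A = 0" using M4 \<rho> by metis
    then have "jump_map H (x, \<rho>\<^sub>d x) \<in> A"
      using A by (simp add: in_closed_iff_infdist_zero compact_imp_closed)
    then have "V (jump_map H (x, \<rho>\<^sub>d x)) = 0"
      using V_zero[of "jump_map H (x, \<rho>\<^sub>d x)"] d_feasible[OF x] by blast
    then show ?thesis using \<open>V x = 0\<close> True \<alpha>\<^sub>3 by (simp add: pos_def_fun_def)
  qed
  interpret closed_loop: hybrid_lyapunov A "{x \<in> Pi_c H. (x, \<rho>\<^sub>c x) \<in> flow_set H}" "\<lambda>x. flow_map H (x, \<rho>\<^sub>c x)"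
    "{x \<in> Pi_d H. (x, \<rho>\<^sub>d x) \<in> jump_set H}" "\<lambda>x. jump_map H (x, \<rho>\<^sub>d x)" V X \<alpha>\<^sub>1 \<alpha>\<^sub>2 \<alpha>\<^sub>3
  proof
    have "closure {x \<in> Pi_c H. (x, \<rho>\<^sub>c x) \<in> flow_set H} \<subseteq> closure (Pi_c H)"
      by (rule closure_mono) auto
    then show "closure {x \<in> Pi_c H. (x, \<rho>\<^sub>c x) \<in> flow_set H} \<subseteq> X" using X(2) by blast
    show "\<alpha>\<^sub>1 (infdist x A) \<le> V x \<and> V x \<le> \<alpha>\<^sub>2 (infdist x A)"
      if "x \<in> {x \<in> Pi_c H. (x, \<rho>\<^sub>c x) \<in> flow_set H} \<union> {x \<in> Pi_d H. (x, \<rho>\<^sub>d x) \<in> jump_set H}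
        \<union> (\<lambda>x. jump_map H (x, \<rho>\<^sub>d x)) ` {x \<in> Pi_d H. (x, \<rho>\<^sub>d x) \<in> jump_set H}" for x
      using that by (intro bounds) auto
  qed (use A V X \<alpha> \<alpha>\<^sub>3 flow jump in auto)
  show "renders_GAS H A \<rho>\<^sub>c \<rho>\<^sub>d"
    unfolding renders_GAS_def by (rule closed_loop.asymptotically_stable)

  have cont_maps: "continuous_on UNIV (flow_map H)" "continuous_on UNIV (jump_map H)"
    using HBC by (auto simp: hybrid_basic_conditions_def)
  have cont_\<alpha>\<^sub>3: "continuous_on UNIV (\<lambda>x. \<alpha>\<^sub>3 (infdist x A))"
    using \<alpha>\<^sub>3 unfolding pos_def_fun_def
    by (auto intro!: continuous_on_compose2[of "{0..}" \<alpha>\<^sub>3 UNIV "\<lambda>x. infdist x A"] continuous_intros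
        simp: infdist_nonneg)

  assume closed_graph_and_zero: "has_closed_graph (Psi_c H) \<and> has_closed_graph (Psi_d H) \<and>
       (\<forall>x\<in>A. \<rho>\<^sub>c\<^sub>0 x = 0) \<and> (\<forall>x\<in>A. \<rho>\<^sub>d\<^sub>0 x = 0)"
  show "continuous_on (Pi_c H) \<rho>\<^sub>c"
  proof (rule min_norm_feedback_continuous[where T = "T'_c H A V \<alpha>\<^sub>3 \<rho>\<^sub>c\<^sub>0" and V = V and \<Psi> = "Psi_c H" and X = X
        and \<gamma> = "\<lambda>x u. grad V x \<bullet> flow_map H (x, u) + \<alpha>\<^sub>3 (infdist x A)"])
    fix x assume x: "x \<in> Pi_c H"
    show "T'_c H A V \<alpha>\<^sub>3 \<rho>\<^sub>c\<^sub>0 x = (if V x = 0 then Psi_c H x \<inter> {0}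
        else {u \<in> Psi_c H x. grad V x \<bullet> flow_map H (x, u) + \<alpha>\<^sub>3 (infdist x A) \<le> 0})"
      using T'_c_eq[OF HBC x, of A V \<alpha>\<^sub>3 \<rho>\<^sub>c\<^sub>0] V_zero[of x] x closed_graph_and_zero by simp
    show "lsc_at (T'_c H A V \<alpha>\<^sub>3 \<rho>\<^sub>c\<^sub>0) x" using M5 x V_nonneg[of x] by (simp add: superlevel_def)
    show "is_arg_min norm (\<lambda>u. u \<in> T'_c H A V \<alpha>\<^sub>3 \<rho>\<^sub>c\<^sub>0 x) (\<rho>\<^sub>c x)" using rho_c x by blast
    assume "V x \<noteq> 0"
    then have "V x > 0" using V_nonneg[of x] x by simp
    then have "ereal_convex_on (Psi_c H x) (\<lambda>u. Gamma_c H A V \<alpha>\<^sub>3 x u (V x))"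
      using M2(1) x by (simp add: superlevel_def)
    then have "convex {u \<in> Psi_c H x. grad V x \<bullet> flow_map H (x, u) + \<alpha>\<^sub>3 (infdist x A) \<le> 0}"
      by (rule convex_sublevel_if_ereal_convex_on) (simp add: Gamma_c_def superlevel_def Psi_c_def)
    then show "convex (T'_c H A V \<alpha>\<^sub>3 \<rho>\<^sub>c\<^sub>0 x)" using \<open>V x \<noteq> 0\<close> by (simp add: T'_c_eq[OF HBC x])
  next
    show "continuous_on (X \<times> UNIV) (\<lambda>(x, u). grad V x \<bullet> flow_map H (x, u) + \<alpha>\<^sub>3 (infdist x A))"
      unfolding case_prod_unfold
      using X(3) unfolding C1_on_def
      by (auto intro!: continuous_intros continuous_on_compose2[of X "grad V" _ fst]
          continuous_on_subset[OF cont_maps(1)]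
          continuous_on_compose2[OF cont_\<alpha>\<^sub>3, where f = fst])
    show "Pi_c H \<subseteq> X" using X(2) closure_subset by blast
  qed (use V closed_graph_and_zero in auto)
  show "continuous_on (Pi_d H) \<rho>\<^sub>d"
  proof (rule min_norm_feedback_continuous[where T = "T'_d H A V \<alpha>\<^sub>3 \<rho>\<^sub>d\<^sub>0" and V = V and \<Psi> = "Psi_d H" and X = UNIV
        and \<gamma> = "\<lambda>x u. V (jump_map H (x, u)) - V x + \<alpha>\<^sub>3 (infdist x A)"])
    fix x assume x: "x \<in> Pi_d H"
    show "T'_d H A V \<alpha>\<^sub>3 \<rho>\<^sub>d\<^sub>0 x = (if V x = 0 then Psi_d H x \<inter> {0}
        else {u \<in> Psi_d H x. V (jump_map H (x, u)) - V x + \<alpha>\<^sub>3 (infdist x A) \<le> 0})"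
      using T'_d_eq[OF HBC x, of A V \<alpha>\<^sub>3 \<rho>\<^sub>d\<^sub>0] V_zero[of x] x closed_graph_and_zero by simp
    show "lsc_at (T'_d H A V \<alpha>\<^sub>3 \<rho>\<^sub>d\<^sub>0) x" using M6 x V_nonneg[of x] by (simp add: superlevel_def)
    show "is_arg_min norm (\<lambda>u. u \<in> T'_d H A V \<alpha>\<^sub>3 \<rho>\<^sub>d\<^sub>0 x) (\<rho>\<^sub>d x)" using rho_d x by blast
    assume "V x \<noteq> 0"
    then have "V x > 0" using V_nonneg[of x] x by simp
    then have "ereal_convex_on (Psi_d H x) (\<lambda>u. Gamma_d H A V \<alpha>\<^sub>3 x u (V x))"
      using M2(2) x by (simp add: superlevel_def)
    then have "convex {u \<in> Psi_d H x. V (jump_map H (x, u)) - V x + \<alpha>\<^sub>3 (infdist x A) \<le> 0}"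
      by (rule convex_sublevel_if_ereal_convex_on) (simp add: Gamma_d_def superlevel_def Psi_d_def)
    then show "convex (T'_d H A V \<alpha>\<^sub>3 \<rho>\<^sub>d\<^sub>0 x)" using \<open>V x \<noteq> 0\<close> by (simp add: T'_d_eq[OF HBC x])
  next
    have "continuous_on UNIV (\<lambda>p. V (jump_map H p))"
      using continuous_on_compose2[OF V cont_maps(2)] by simp
    then show "continuous_on (UNIV \<times> UNIV) (\<lambda>(x, u). V (jump_map H (x, u)) - V x + \<alpha>\<^sub>3 (infdist x A))"
      unfolding case_prod_unfold
      by (auto intro!: continuous_intros continuous_on_compose2[OF V, where f = fst]
          continuous_on_compose2[OF cont_\<alpha>\<^sub>3, where f = fst])
  qed (use V closed_graph_and_zero in auto)
qed

end
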